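(* Let $n\ge 1$ and let $s=\left\lceil \frac{2^n}{n+1}\right\rceil$. Then a generic tensor in $(\mathbb{C}^2)^{\otimes n}$ (that is, a generic $\mathbb{C}$-tensor of format $2\times\cdots\times 2$, $n$ times) can be written as a sum of $s$ decomposable tensors, and cannot be written as a sum of fewer than $s$ decomposable tensors.
   Context: A tensor in $(\mathbb{C}^2)^{\otimes n}$ is decomposable if it has the form $v_1\otimes\cdots\otimes v_n$ with $v_i\in\mathbb{C}^2$. "A generic tensor has property P" means that P holds for all tensors in some nonempty Zariski-open subset of $(\mathbb{C}^2)^{\otimes n}$. *)

theory Defs
  imports "HOL-Analysis.Analysis"
begin

text \<open>
  A tensor of format \<open>2 \<times> \<dots> \<times> 2\<close> (\<open>n\<close> factors) is given by its coordinates in the basis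
  \<open>e\<^sub>i\<^sub>1 \<otimes> \<dots> \<otimes> e\<^sub>i\<^sub>n\<close>. A multi-index is a list of length \<open>n\<close> over the two-element index type of
  \<^typ>\<open>complex ^ 2\<close>; entries at lists of any other length are required to be zero, so that
  equality of functions is equality of tensors.
\<close>

type_synonym tensor = "2 list \<Rightarrow> complex"

definition tensors :: "nat \<Rightarrow> tensor set" where
  "tensors n = {T. \<forall>i. length i \<noteq> n \<longrightarrow> T i = 0}"

definition tensor_product :: "(complex ^ 2) list \<Rightarrow> tensor" where
  "tensor_product vs =
     (\<lambda>i. if length i = length vs then \<Prod>k<length vs. (vs ! k) $ (i ! k) else 0)"

definition decomposable :: "nat \<Rightarrow> tensor \<Rightarrow> bool" where
  "decomposable n T \<longleftrightarrow> (\<exists>vs. length vs = n \<and> T = tensor_product vs)"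

definition sum_of_decomposables :: "nat \<Rightarrow> nat \<Rightarrow> tensor \<Rightarrow> bool" where
  "sum_of_decomposables n r T \<longleftrightarrow>
     (\<exists>D. (\<forall>j<r. decomposable n (D j)) \<and> T = (\<lambda>i. \<Sum>j<r. D j i))"

text \<open>The functions on tensors given by polynomials in the \<open>2\<^sup>n\<close> coordinates.\<close>

inductive_set polynomial_functions :: "nat \<Rightarrow> (tensor \<Rightarrow> complex) set" for n :: nat where
  const: "(\<lambda>T. c) \<in> polynomial_functions n"
| coord: "length i = n \<Longrightarrow> (\<lambda>T. T i) \<in> polynomial_functions n"
| add: "p \<in> polynomial_functions n \<Longrightarrow> q \<in> polynomial_functions n \<Longrightarrow>
        (\<lambda>T. p T + q T) \<in> polynomial_functions n"
| mult: "p \<in> polynomial_functions n \<Longrightarrow> q \<in> polynomial_functions n \<Longrightarrow>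
        (\<lambda>T. p T * q T) \<in> polynomial_functions n"

definition zariski_closed :: "nat \<Rightarrow> tensor set \<Rightarrow> bool" where
  "zariski_closed n Z \<longleftrightarrow>
     (\<exists>S \<subseteq> polynomial_functions n. Z = {T \<in> tensors n. \<forall>p\<in>S. p T = 0})"

definition zariski_open :: "nat \<Rightarrow> tensor set \<Rightarrow> bool" where
  "zariski_open n U \<longleftrightarrow> U \<subseteq> tensors n \<and> zariski_closed n (tensors n - U)"

definition generic_tensor :: "nat \<Rightarrow> (tensor \<Rightarrow> bool) \<Rightarrow> bool" where
  "generic_tensor n P \<longleftrightarrow> (\<exists>U. zariski_open n U \<and> U \<noteq> {} \<and> (\<forall>T\<in>U. P T))"

end

theory Submission
  imports Defs "HOL-Computational_Algebra.Fundamental_Theorem_Algebra"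
begin

text \<open>
  A multilinear form on \<open>(\<complex>\<^sup>2)\<^sup>m\<close> is identified with its coefficient function. By Terracini's
  lemma, sums of \<open>s\<close> decomposable tensors are Zariski dense as soon as, for some choice of
  \<open>s\<close> points, no nonzero form is singular at all of them; by Chevalley's theorem they then contain a
  nonempty open set. To find such points, put some of them at the two coordinate points of one
  factor: a form splits into two forms with one argument less, and a point that is double for one
  of them is simple for the other. Even splittings suffice unless \<open>s\<close> is odd. For odd \<open>s\<close> the
  counts of a single splitting do not balance; there two factors are split at once into four
  blocks, and points tending to a corner of the square along a suitable curve become, in the limit,
  double in one block and simple in the opposite block and in only one of the two adjacent blocks.
  These points make the counts come out exactly.

  That fewer summands do not suffice is a dimension count: composing the monomials of bounded degree
  in the \<open>2\<^sup>n\<close> coordinates with the sum of \<open>r\<close> decomposable tensors gives functions in a space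
  whose dimension grows with exponent \<open>r (n + 1) < 2\<^sup>n\<close> only, so they are linearly dependent.
\<close>

section \<open>Polynomial functions and separating families\<close>

text \<open>A double point costs n + 1 conditions, and the generic number of points leaves a surplus
  of at most n. For s = 2 * h + 1 a single splitting gives one half h + 1 double and h simple points
  and the other half the reverse, so the counts differ by n - 1, and the poorer half may fall short
  although the total is large enough. Four blocks with points of types \<open>p\<close> and
  \<open>q\<close> alone do not help: put k = n - 1, the number of conditions of a double point in a
  block; then opposite blocks receive the same number of simple points, and since s is odd some
  opposite pair differs by at least k. Points of type \<open>x\<close> break this symmetry, because
  one at (1,1) gives its opposite simple condition to (2,2). One extra double point at (1,1) is
  compensated exactly by having k more points of type \<open>x\<close> at (1,1) than at (2,2). Both
  diagonal blocks are then filled without waste, and the whole surplus is left to the other two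
  blocks.\<close>

inductive_set polyfun :: "(('v \<Rightarrow> complex) \<Rightarrow> complex) set" where
  const: "(\<lambda>c. a) \<in> polyfun"
| var: "(\<lambda>c. c v) \<in> polyfun"
| add: "P \<in> polyfun \<Longrightarrow> Q \<in> polyfun \<Longrightarrow> (\<lambda>c. P c + Q c) \<in> polyfun"
| mult: "P \<in> polyfun \<Longrightarrow> Q \<in> polyfun \<Longrightarrow> (\<lambda>c. P c * Q c) \<in> polyfun"

lemma polyfun_diff:
  assumes "P \<in> polyfun" "Q \<in> polyfun"
  shows "(\<lambda>c. P c - Q c) \<in> polyfun"
  using polyfun.add[OF assms(1) polyfun.mult[OF polyfun.const[of "-1"] assms(2)]] by simp

lemma polyfun_sum:
  "(\<And>i. i \<in> I \<Longrightarrow> P i \<in> polyfun) \<Longrightarrow> (\<lambda>c. \<Sum>i\<in>I. P i c) \<in> polyfun"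
  by (induction I rule: infinite_finite_induct) (auto intro: polyfun.intros)

lemma polyfun_prod:
  "(\<And>i. i \<in> I \<Longrightarrow> P i \<in> polyfun) \<Longrightarrow> (\<lambda>c. \<Prod>i\<in>I. P i c) \<in> polyfun"
  by (induction I rule: infinite_finite_induct) (auto intro: polyfun.intros)

lemma polyfun_power: "P \<in> polyfun \<Longrightarrow> (\<lambda>c. P c ^ k) \<in> polyfun"
  by (induction k) (auto intro: polyfun.intros)

lemma polyfun_subst:
  assumes "P \<in> polyfun" "\<And>v. (\<lambda>d. S d v) \<in> polyfun"
  shows "(\<lambda>d. P (S d)) \<in> polyfun"
  using assms(1) by induction (auto intro: polyfun.intros assms(2))

lemma polyfun_line:
  assumes "P \<in> polyfun"
  shows "\<exists>p. \<forall>z. P (\<lambda>v. a v + z * b v) = poly p z"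
  using assms
proof induction
  case (const k)
  show ?case by (rule exI[of _ "[:k:]"]) simp
next
  case (var v)
  show ?case by (rule exI[of _ "[:a v, b v:]"]) simp
next
  case (add P Q)
  then show ?case by (metis poly_add)
next
  case (mult P Q)
  then show ?case by (metis poly_mult)
qed

text \<open>Irreducibility of affine space: on the line through \<open>a\<close> and
  \<open>b\<close> both functions become nonzero polynomials in one variable, and hence so does
  their product.\<close>

lemma polyfun_common_nonzero:
  assumes "P \<in> polyfun" "Q \<in> polyfun" "P a \<noteq> 0" "Q b \<noteq> 0"
  shows "\<exists>c. P c \<noteq> 0 \<and> Q c \<noteq> 0"
proof -
  obtain p where p: "\<And>z. P (\<lambda>v. a v + z * (b v - a v)) = poly p z"
    using polyfun_line[OF assms(1), of a "\<lambda>v. b v - a v"] by auto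
  obtain q where q: "\<And>z. Q (\<lambda>v. a v + z * (b v - a v)) = poly q z"
    using polyfun_line[OF assms(2), of a "\<lambda>v. b v - a v"] by auto
  have "p \<noteq> 0" using p[of 0] assms(3) by auto
  moreover have "q \<noteq> 0" using q[of 1] assms(4) by auto
  ultimately have "p * q \<noteq> 0" by simp
  then obtain z where "poly (p * q) z \<noteq> 0" using poly_all_0_iff_0 by blast
  then show ?thesis by (intro exI[of _ "\<lambda>v. a v + z * (b v - a v)"]) (simp add: p q)
qed

section \<open>Properties that hold on a nonempty principal open set\<close>

definition generically :: "(('v \<Rightarrow> complex) \<Rightarrow> bool) \<Rightarrow> bool" where
  "generically Q \<longleftrightarrow> (\<exists>P\<in>polyfun. (\<exists>c. P c \<noteq> 0) \<and> (\<forall>c. P c \<noteq> 0 \<longrightarrow> Q c))"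

lemma genericallyI:
  assumes "P \<in> polyfun" "P a \<noteq> 0" "\<And>c. P c \<noteq> 0 \<Longrightarrow> Q c"
  shows "generically Q"
  unfolding generically_def
  by (intro bexI[of _ P] conjI allI impI exI[of _ a]) (fact assms)+

lemma generically_conj:
  assumes "generically Q" "generically R"
  shows "generically (\<lambda>c. Q c \<and> R c)"
proof -
  from assms(1) obtain P where P: "P \<in> polyfun" "\<exists>c. P c \<noteq> 0" "\<forall>c. P c \<noteq> 0 \<longrightarrow> Q c"
    unfolding generically_def by (elim bexE conjE)
  from assms(2) obtain P' where P': "P' \<in> polyfun" "\<exists>c. P' c \<noteq> 0" "\<forall>c. P' c \<noteq> 0 \<longrightarrow> R c"
    unfolding generically_def by (elim bexE conjE)
  from P(2) P'(2) obtain a b where "P a \<noteq> 0" "P' b \<noteq> 0" by (elim exE)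
  then have "\<exists>c. P c \<noteq> 0 \<and> P' c \<noteq> 0" by (rule polyfun_common_nonzero[OF P(1) P'(1)])
  then obtain c where "P c \<noteq> 0" "P' c \<noteq> 0" by (elim exE conjE)
  then show ?thesis
    using P(3) P'(3) by (intro genericallyI[OF polyfun.mult[OF P(1) P'(1)], of c]) simp_all
qed

lemma generically_True: "generically (\<lambda>c. True)"
  by (rule genericallyI[where P = "\<lambda>c. 1" and a = undefined]) (simp_all add: polyfun.const)

lemma generically_Ball:
  "finite E \<Longrightarrow> (\<And>e. e \<in> E \<Longrightarrow> generically (Q e)) \<Longrightarrow> generically (\<lambda>c. \<forall>e\<in>E. Q e c)"
proof (induction E rule: finite_induct)
  case empty
  show ?case by (simp add: generically_True)
next
  case (insert e E)
  then have "generically (\<lambda>c. Q e c \<and> (\<forall>e\<in>E. Q e c))" by (intro generically_conj) simp_all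
  then show ?case by simp
qed

lemma generically_ex: "generically Q \<Longrightarrow> \<exists>c. Q c"
  unfolding generically_def by (elim bexE conjE exE) (rule exI, erule allE, erule (1) mp)

text \<open>For finite \<open>A\<close> this is the dual form of spanning: restricted to
  \<open>A\<close>, the vectors in \<open>V\<close> span all functions on \<open>A\<close>. In the
  applications the functional \<open>\<phi>\<close> is a form and the vectors are the conditions
  imposed on it.\<close>

definition separating :: "'a set \<Rightarrow> ('a \<Rightarrow> complex) set \<Rightarrow> bool" where
  "separating A V \<longleftrightarrow> (\<forall>\<phi>. (\<forall>v\<in>V. (\<Sum>\<alpha>\<in>A. \<phi> \<alpha> * v \<alpha>) = 0) \<longrightarrow> (\<forall>\<alpha>\<in>A. \<phi> \<alpha> = 0))"

lemma separatingD:
  "separating A V \<Longrightarrow> (\<And>v. v \<in> V \<Longrightarrow> (\<Sum>\<alpha>\<in>A. \<phi> \<alpha> * v \<alpha>) = 0) \<Longrightarrow> \<alpha> \<in> A \<Longrightarrow> \<phi> \<alpha> = 0"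
  unfolding separating_def by blast

lemma separating_mono:
  assumes "separating A V" "V \<subseteq> W"
  shows "separating A W"
  unfolding separating_def
proof (intro allI impI ballI)
  fix \<phi> \<alpha> assume "\<forall>v\<in>W. (\<Sum>\<alpha>\<in>A. \<phi> \<alpha> * v \<alpha>) = 0" "\<alpha> \<in> A"
  with assms show "\<phi> \<alpha> = 0" by (intro separatingD[OF assms(1), of \<phi>]) auto
qed

lemma separating_pivot:
  assumes "separating (insert \<alpha> A) V" "finite A" "\<alpha> \<notin> A"
  obtains v where "v \<in> V" "v \<alpha> \<noteq> 0"
proof -
  have "\<exists>v\<in>V. v \<alpha> \<noteq> 0"
  proof (rule ccontr)
    assume no: "\<not> (\<exists>v\<in>V. v \<alpha> \<noteq> 0)"
    have "(\<Sum>\<beta>\<in>insert \<alpha> A. (if \<beta> = \<alpha> then 1 else 0) * v \<beta>) = 0" if "v \<in> V" for v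
      using that assms(2,3) no by (intro sum.neutral) auto
    from separatingD[OF assms(1) this, of \<alpha>] show False by simp
  qed
  then show thesis using that by blast
qed

text \<open>One step of Gaussian elimination with pivot \<open>v \<alpha>\<close>, written without
  division so that entries depending polynomially on parameters keep doing so.\<close>

lemma separating_eliminate:
  assumes sep: "separating (insert \<alpha> A) V" and fin: "finite A" "\<alpha> \<notin> A"
    and v: "v \<in> V" "v \<alpha> \<noteq> 0"
  shows "separating A ((\<lambda>w \<beta>. v \<alpha> * w \<beta> - w \<alpha> * v \<beta>) ` V)"
  unfolding separating_def
proof (intro allI impI)
  fix \<phi> assume *: "\<forall>u\<in>(\<lambda>w \<beta>. v \<alpha> * w \<beta> - w \<alpha> * v \<beta>) ` V. (\<Sum>\<beta>\<in>A. \<phi> \<beta> * u \<beta>) = 0"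
  \<comment> \<open>The value at \<open>\<alpha>\<close> is forced by the requirement that the
    extended functional kill \<open>v\<close>.\<close>
  define \<psi> where "\<psi> = \<phi>(\<alpha> := - (\<Sum>\<beta>\<in>A. \<phi> \<beta> * v \<beta>) / v \<alpha>)"
  have \<psi>A: "(\<Sum>\<beta>\<in>A. \<psi> \<beta> * w \<beta>) = (\<Sum>\<beta>\<in>A. \<phi> \<beta> * w \<beta>)" for w
    by (rule sum.cong) (use fin in \<open>auto simp: \<psi>_def\<close>)
  have "(\<Sum>\<beta>\<in>insert \<alpha> A. \<psi> \<beta> * w \<beta>) = 0" if w: "w \<in> V" for w
  proof -
    have "v \<alpha> * (\<Sum>\<beta>\<in>A. \<phi> \<beta> * w \<beta>) = w \<alpha> * (\<Sum>\<beta>\<in>A. \<phi> \<beta> * v \<beta>)"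
      using bspec[OF *, OF imageI[OF w]]
      by (simp add: algebra_simps sum_subtractf sum_distrib_left)
    then show ?thesis using fin v(2) by (simp add: \<psi>A, simp add: \<psi>_def field_simps)
  qed
  then have "\<psi> \<beta> = 0" if "\<beta> \<in> insert \<alpha> A" for \<beta>
    using separatingD[OF sep] that by blast
  then have "(if \<beta> = \<alpha> then \<psi> \<alpha> else \<phi> \<beta>) = 0" if "\<beta> \<in> A" for \<beta>
    using that by (force simp: \<psi>_def)
  then show "\<forall>\<beta>\<in>A. \<phi> \<beta> = 0" using fin(2) by (metis (full_types))
qed

text \<open>Gaussian elimination: a pivot that is nonzero at \<open>c0\<close> stays nonzero on a Zariski open set.\<close>

lemma separating_open:
  fixes b :: "'i \<Rightarrow> ('v \<Rightarrow> complex) \<Rightarrow> 'a \<Rightarrow> complex"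
  assumes "finite A" "\<And>i \<alpha>. i \<in> I \<Longrightarrow> \<alpha> \<in> A \<Longrightarrow> (\<lambda>c. b i c \<alpha>) \<in> polyfun"
    and "separating A ((\<lambda>i. b i c0) ` I)"
  shows "\<exists>P\<in>polyfun. P c0 \<noteq> 0 \<and> (\<forall>c. P c \<noteq> 0 \<longrightarrow> separating A ((\<lambda>i. b i c) ` I))"
  using assms
proof (induction A arbitrary: b rule: finite_induct)
  case empty
  show ?case using polyfun.const[of 1] by (intro bexI[of _ "\<lambda>c. 1"]) (simp_all add: separating_def)
next
  case (insert \<alpha> A)
  obtain i where i: "i \<in> I" "b i c0 \<alpha> \<noteq> 0"
    using separating_pivot[OF insert.prems(2) insert.hyps] by auto
  define b' where "b' j c \<beta> = b i c \<alpha> * b j c \<beta> - b j c \<alpha> * b i c \<beta>" for j c \<beta>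
  have "separating A ((\<lambda>j. b' j c0) ` I)"
    using separating_eliminate[OF insert.prems(2) insert.hyps, of "b i c0"] i
    unfolding b'_def[abs_def] image_image by simp
  moreover have "(\<lambda>c. b' j c \<beta>) \<in> polyfun" if "j \<in> I" "\<beta> \<in> A" for j \<beta>
    unfolding b'_def using that i insert.prems(1) by (intro polyfun_diff polyfun.mult) auto
  ultimately have "\<exists>P\<in>polyfun. P c0 \<noteq> 0 \<and> (\<forall>c. P c \<noteq> 0 \<longrightarrow> separating A ((\<lambda>j. b' j c) ` I))"
    by (intro insert.IH)
  then obtain P where P: "P \<in> polyfun" "P c0 \<noteq> 0"
    and sepP: "\<forall>c. P c \<noteq> 0 \<longrightarrow> separating A ((\<lambda>j. b' j c) ` I)"
    by (elim bexE conjE)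
  have "separating (insert \<alpha> A) ((\<lambda>j. b j c) ` I)" if c: "P c * b i c \<alpha> \<noteq> 0" for c
    unfolding separating_def
  proof (intro allI impI)
    fix \<phi> assume *: "\<forall>v\<in>(\<lambda>j. b j c) ` I. (\<Sum>\<beta>\<in>insert \<alpha> A. \<phi> \<beta> * v \<beta>) = 0"
    then have 1: "\<phi> \<alpha> * b j c \<alpha> + (\<Sum>\<beta>\<in>A. \<phi> \<beta> * b j c \<beta>) = 0" if "j \<in> I" for j
      using that insert.hyps by auto
    have "(\<Sum>\<beta>\<in>A. \<phi> \<beta> * b' j c \<beta>) = 0" if "j \<in> I" for j
    proof -
      have "(\<Sum>\<beta>\<in>A. \<phi> \<beta> * b' j c \<beta>) = b i c \<alpha> * (\<Sum>\<beta>\<in>A. \<phi> \<beta> * b j c \<beta>) - b j c \<alpha> * (\<Sum>\<beta>\<in>A. \<phi> \<beta> * b i c \<beta>)"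
        by (simp add: b'_def algebra_simps sum_subtractf sum_distrib_left)
      also have "\<dots> = 0" using 1[OF that] 1[OF i(1)] by algebra
      finally show ?thesis .
    qed
    moreover have "separating A ((\<lambda>j. b' j c) ` I)" using sepP c by simp
    ultimately have 2: "\<phi> \<beta> = 0" if "\<beta> \<in> A" for \<beta>
      using that by (auto dest: separatingD)
    then have "\<phi> \<alpha> * b i c \<alpha> = 0" using 1[OF i(1)] by simp
    with 2 c show "\<forall>\<beta>\<in>insert \<alpha> A. \<phi> \<beta> = 0" by auto
  qed
  moreover have "(\<lambda>c. P c * b i c \<alpha>) \<in> polyfun"
    using insert.prems(1) i P(1) by (intro polyfun.mult) auto
  moreover have "P c0 * b i c0 \<alpha> \<noteq> 0" using P(2) i(2) by simp
  ultimately show ?case by (intro bexI[of _ "\<lambda>c. P c * b i c \<alpha>"] conjI allI impI)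
qed

text \<open>A subspace annihilated by no nonzero functional surjects onto the functions on
  \<open>A\<close>. A vector \<open>v\<close> with \<open>v \<alpha> \<noteq> 0\<close> corrects the
  value at \<open>\<alpha>\<close>; the other values are obtained inside the subspace of vectors
  vanishing at \<open>\<alpha>\<close>.\<close>

lemma separating_subspace:
  assumes "finite A" "separating A V" "(\<lambda>\<alpha>. 0) \<in> V"
    and "\<And>u v k. u \<in> V \<Longrightarrow> v \<in> V \<Longrightarrow> (\<lambda>\<alpha>. u \<alpha> + k * v \<alpha>) \<in> V"
  shows "\<exists>v\<in>V. \<forall>\<alpha>\<in>A. v \<alpha> = y \<alpha>"
  using assms
proof (induction A arbitrary: y V rule: finite_induct)
  case empty
  then show ?case by auto
next
  case (insert \<alpha> A)
  obtain v where v: "v \<in> V" "v \<alpha> \<noteq> 0"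
    using separating_pivot[OF insert.prems(1) insert.hyps] by auto
  define V' where "V' = {w \<in> V. w \<alpha> = 0}"
  have scale: "(\<lambda>\<beta>. k * u \<beta>) \<in> V" if "u \<in> V" for u k
    using insert.prems(3)[OF insert.prems(2) that, of k] by simp
  have sub: "(\<lambda>w \<beta>. v \<alpha> * w \<beta> - w \<alpha> * v \<beta>) ` V \<subseteq> V'"
  proof clarify
    fix w assume "w \<in> V"
    then show "(\<lambda>\<beta>. v \<alpha> * w \<beta> - w \<alpha> * v \<beta>) \<in> V'"
      using insert.prems(3)[OF scale[of w "v \<alpha>"] v(1), of "- w \<alpha>"] by (simp add: V'_def)
  qed
  have "separating A V'"
    using separating_eliminate[OF insert.prems(1) insert.hyps v] sub by (rule separating_mono)
  moreover have "(\<lambda>\<alpha>. 0) \<in> V'" using insert.prems(2) by (simp add: V'_def)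
  moreover have "(\<lambda>\<alpha>. u \<alpha> + k * v \<alpha>) \<in> V'" if "u \<in> V'" "v \<in> V'" for u v k
    using that insert.prems(3) by (simp add: V'_def)
  ultimately have "\<exists>w\<in>V'. \<forall>\<beta>\<in>A. w \<beta> = y \<beta> - y \<alpha> / v \<alpha> * v \<beta>"
    by (intro insert.IH)
  then obtain w where w: "w \<in> V'" "\<forall>\<beta>\<in>A. w \<beta> = y \<beta> - y \<alpha> / v \<alpha> * v \<beta>" ..
  have "(\<lambda>\<beta>. w \<beta> + y \<alpha> / v \<alpha> * v \<beta>) \<in> V"
    using insert.prems(3)[of w v "y \<alpha> / v \<alpha>"] w(1) v(1) by (simp add: V'_def)
  moreover have "\<forall>\<beta>\<in>insert \<alpha> A. w \<beta> + y \<alpha> / v \<alpha> * v \<beta> = y \<beta>"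
    using w v(2) by (auto simp: V'_def)
  ultimately show ?case by (intro bexI[of _ "\<lambda>\<beta>. w \<beta> + y \<alpha> / v \<alpha> * v \<beta>"])
qed

section \<open>Multilinear forms, double points and simple points\<close>

definition idx :: "nat \<Rightarrow> 2 list set" where
  "idx m = {\<alpha>. length \<alpha> = m}"

definition tp :: "nat \<Rightarrow> (nat \<Rightarrow> 2 \<Rightarrow> complex) \<Rightarrow> tensor" where
  "tp m x \<alpha> = (\<Prod>k<m. x k (\<alpha> ! k))"

definition ev :: "nat \<Rightarrow> tensor \<Rightarrow> (nat \<Rightarrow> 2 \<Rightarrow> complex) \<Rightarrow> complex" where
  "ev m \<phi> x = (\<Sum>\<alpha>\<in>idx m. \<phi> \<alpha> * tp m x \<alpha>)"

text \<open>The directions in which a form must vanish to be singular at a point; \<open>None\<close> stands for the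
  point itself, which is not redundant for \<open>m = 0\<close>.\<close>

definition dirs :: "nat \<Rightarrow> (nat \<times> (2 \<Rightarrow> complex)) option set" where
  "dirs m = insert None (Some ` ({..<m} \<times> UNIV))"

definition bump :: "(nat \<times> (2 \<Rightarrow> complex)) option \<Rightarrow> (nat \<Rightarrow> 2 \<Rightarrow> complex) \<Rightarrow> nat \<Rightarrow> 2 \<Rightarrow> complex" where
  "bump d x = (case d of None \<Rightarrow> x | Some (i, u) \<Rightarrow> x(i := u))"

text \<open>A form is linear in each factor, so its derivative at \<open>x\<close> along
  \<open>u\<close> in factor \<open>i\<close> is its value with \<open>x i\<close> replaced by
  \<open>u\<close>; for \<open>u = x i\<close> this is the value at \<open>x\<close>.\<close>

definition sing :: "nat \<Rightarrow> tensor \<Rightarrow> (nat \<Rightarrow> 2 \<Rightarrow> complex) \<Rightarrow> bool" where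
  "sing m \<phi> x \<longleftrightarrow> (\<forall>d\<in>dirs m. ev m \<phi> (bump d x) = 0)"

definition fills :: "nat \<Rightarrow> 'i set \<Rightarrow> 'i set \<Rightarrow> ('i \<Rightarrow> nat \<Rightarrow> 2 \<Rightarrow> complex) \<Rightarrow> bool" where
  "fills m A B X \<longleftrightarrow>
     (\<forall>\<phi>. (\<forall>j\<in>A. sing m \<phi> (X j)) \<longrightarrow> (\<forall>j\<in>B. ev m \<phi> (X j) = 0) \<longrightarrow> (\<forall>\<alpha>\<in>idx m. \<phi> \<alpha> = 0))"

definition Fill :: "nat \<Rightarrow> nat \<Rightarrow> nat \<Rightarrow> bool" where
  "Fill m t b \<longleftrightarrow> (\<exists>X :: nat \<Rightarrow> nat \<Rightarrow> 2 \<Rightarrow> complex. fills m {..<t} {t..<t+b} X)"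

text \<open>The two elements of the index type \<^typ>\<open>2\<close> are written \<open>1\<close> and \<open>2\<close>, where \<open>2 = 0\<close>.\<close>

lemma bit_neq [simp]: "(1::2) \<noteq> 2" "(2::2) \<noteq> 1"
  by simp_all

lemma finite_idx [simp]: "finite (idx m)"
  using finite_lists_length_eq[of "UNIV :: 2 set" m] by (simp add: idx_def)

lemma idx_0 [simp]: "idx 0 = {[]}"
  by (auto simp: idx_def)

lemma sum_idx_Suc: "(\<Sum>\<alpha>\<in>idx (Suc m). f \<alpha>) = (\<Sum>b\<in>UNIV. \<Sum>\<alpha>\<in>idx m. f (b # \<alpha>))"
proof -
  have "idx (Suc m) = (\<lambda>(b, \<alpha>). b # \<alpha>) ` (UNIV \<times> idx m)"
    by (auto simp: idx_def length_Suc_conv image_iff)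
  moreover have "inj_on (\<lambda>(b, \<alpha>). b # \<alpha>) (UNIV \<times> idx m)"
    by (auto simp: inj_on_def)
  ultimately show ?thesis
    by (simp add: sum.reindex sum.cartesian_product case_prod_unfold)
qed

lemma ev_cons:
  "ev (Suc m) \<phi> (case_nat u x) = (\<Sum>b\<in>UNIV. u b * ev m (\<lambda>\<alpha>. \<phi> (b # \<alpha>)) x)"
  unfolding ev_def sum_idx_Suc tp_def prod.lessThan_Suc_shift
  by (simp add: sum_distrib_left algebra_simps)

lemma bump_cons: "case_nat u (bump d x) = bump (map_option (map_prod Suc id) d) (case_nat u x)"
  by (cases d) (auto simp: bump_def fun_eq_iff split: nat.split)

text \<open>The first claim uses the directions in the old factors, the second the direction
  \<open>u'\<close> in the new one. If \<open>u\<close> is a coordinate vector, one block becomes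
  singular at \<open>x\<close> while the other is only forced to vanish there.\<close>

lemma sing_cons:
  assumes "sing (Suc m) \<phi> (case_nat u x)"
  shows "d \<in> dirs m \<Longrightarrow> (\<Sum>b\<in>UNIV. u b * ev m (\<lambda>\<alpha>. \<phi> (b # \<alpha>)) (bump d x)) = 0"
    and "(\<Sum>b\<in>UNIV. u' b * ev m (\<lambda>\<alpha>. \<phi> (b # \<alpha>)) x) = 0"
proof -
  assume d: "d \<in> dirs m"
  have "map_option (map_prod Suc id) d \<in> dirs (Suc m)"
    using d by (auto simp: dirs_def image_iff)
  then show "(\<Sum>b\<in>UNIV. u b * ev m (\<lambda>\<alpha>. \<phi> (b # \<alpha>)) (bump d x)) = 0"
    using assms unfolding sing_def by (metis ev_cons bump_cons)
next
  have "Some (0, u') \<in> dirs (Suc m)" by (auto simp: dirs_def)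
  moreover have "bump (Some (0, u')) (case_nat u x) = case_nat u' x"
    by (auto simp: bump_def fun_eq_iff split: nat.split)
  ultimately show "(\<Sum>b\<in>UNIV. u' b * ev m (\<lambda>\<alpha>. \<phi> (b # \<alpha>)) x) = 0"
    using assms unfolding sing_def by (metis ev_cons)
qed

lemma fillsD:
  assumes "fills m A B X" "\<And>j. j \<in> A \<Longrightarrow> sing m \<phi> (X j)" "\<And>j. j \<in> B \<Longrightarrow> ev m \<phi> (X j) = 0"
    and "\<alpha> \<in> idx m"
  shows "\<phi> \<alpha> = 0"
  using assms unfolding fills_def by blast

lemma fillsI:
  assumes "\<And>\<phi> \<alpha>. (\<And>j. j \<in> A \<Longrightarrow> sing m \<phi> (X j)) \<Longrightarrow> (\<And>j. j \<in> B \<Longrightarrow> ev m \<phi> (X j) = 0)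
    \<Longrightarrow> \<alpha> \<in> idx m \<Longrightarrow> \<phi> \<alpha> = 0"
  shows "fills m A B X"
  using assms unfolding fills_def by blast

lemma fills_reindex:
  assumes "fills m A B X" "A \<subseteq> h ` A'" "B \<subseteq> h ` B'"
  shows "fills m A' B' (\<lambda>j. X (h j))"
proof (rule fillsI)
  fix \<phi> \<alpha>
  assume *: "\<And>j. j \<in> A' \<Longrightarrow> sing m \<phi> (X (h j))" "\<And>j. j \<in> B' \<Longrightarrow> ev m \<phi> (X (h j)) = 0" "\<alpha> \<in> idx m"
  show "\<phi> \<alpha> = 0"
    using assms(1) by (rule fillsD) (use * assms(2,3) in auto)
qed

lemma Fill_imp_fills:
  assumes "Fill m (card A) (card B)" "finite A" "finite B" "A \<inter> B = {}"
  shows "\<exists>X. fills m A B X"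
proof -
  obtain X :: "nat \<Rightarrow> nat \<Rightarrow> 2 \<Rightarrow> complex" where X: "fills m {..<card A} {card A..<card A + card B} X"
    using assms(1) unfolding Fill_def ..
  obtain f where f: "bij_betw f A {0..<card A}" using ex_bij_betw_finite_nat[OF assms(2)] ..
  obtain g where g: "bij_betw g B {0..<card B}" using ex_bij_betw_finite_nat[OF assms(3)] ..
  define h where "h j = (if j \<in> A then f j else card A + g j)" for j
  have "h ` A = f ` A" by (auto simp: h_def)
  moreover have "h ` B = (\<lambda>j. card A + g j) ` B" using assms(4) by (intro image_cong) (auto simp: h_def)
  then have "h ` B = (+) (card A) ` g ` B" by (simp add: image_image)
  ultimately have "{..<card A} \<subseteq> h ` A" "{card A..<card A + card B} \<subseteq> h ` B"
    using f g by (simp_all add: bij_betw_def lessThan_atLeast0 image_add_atLeastLessThan add.commute)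
  from fills_reindex[OF X this] show ?thesis by (intro exI[of _ "\<lambda>j. X (h j)"])
qed

lemma fills_imp_Fill:
  assumes "fills m A B X" "finite A" "finite B" "card A = t" "card B = b"
  shows "Fill m t b"
proof -
  obtain f where f: "bij_betw f {0..<t} A" using ex_bij_betw_nat_finite[OF assms(2)] assms(4) by auto
  obtain g where g: "bij_betw g {0..<b} B" using ex_bij_betw_nat_finite[OF assms(3)] assms(5) by auto
  define h where "h j = (if j < t then f j else g (j - t))" for j
  have "A \<subseteq> h ` {..<t}"
    using f by (auto simp: h_def bij_betw_def lessThan_atLeast0)
  moreover have "B \<subseteq> h ` {t..<t+b}"
  proof
    fix j assume "j \<in> B"
    then obtain i where "i < b" "j = g i" using g by (auto simp: bij_betw_def)
    then show "j \<in> h ` {t..<t+b}" by (intro image_eqI[of _ _ "t + i"]) (simp_all add: h_def)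
  qed
  ultimately show ?thesis unfolding Fill_def using fills_reindex[OF assms(1)] by blast
qed

lemma fills_iff_separating:
  "fills m A B X \<longleftrightarrow>
    separating (idx m) ((\<lambda>(j, d). tp m (bump d (X j))) ` (A \<times> dirs m \<union> B \<times> {None}))"
proof -
  have "(\<forall>v\<in>(\<lambda>(j, d). tp m (bump d (X j))) ` (A \<times> dirs m \<union> B \<times> {None}). (\<Sum>\<alpha>\<in>idx m. \<phi> \<alpha> * v \<alpha>) = 0)
      \<longleftrightarrow> (\<forall>j\<in>A. sing m \<phi> (X j)) \<and> (\<forall>j\<in>B. ev m \<phi> (X j) = 0)" for \<phi>
    unfolding ball_simps(9) ball_Un split_paired_Ball_Sigma prod.case sing_def ev_def
    by (simp add: bump_def[of None])
  then show ?thesis unfolding fills_def separating_def by (simp only: imp_conjL)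
qed

lemma polyfun_tp_bump:
  assumes "\<And>k b. (\<lambda>c. X c k b) \<in> polyfun"
  shows "(\<lambda>c. tp m (bump d (X c)) \<alpha>) \<in> polyfun"
proof -
  have "(\<lambda>c. bump d (X c) k (\<alpha> ! k)) \<in> polyfun" for k
  proof (cases d)
    case None
    then show ?thesis using assms by (simp add: bump_def)
  next
    case (Some p)
    then show ?thesis
      using assms by (cases "k = fst p") (simp_all add: bump_def polyfun.const case_prod_unfold)
  qed
  then show ?thesis unfolding tp_def by (intro polyfun_prod)
qed

text \<open>Full rank is an open condition on the coordinates of the points. This is what lets a
  single configuration serve several blocks at once.\<close>

lemma fills_generically:
  assumes "fills m A B X"
  shows "generically (\<lambda>c. fills m A B (\<lambda>j k b. c (j, k, b)))"
proof -
  define I where "I = A \<times> dirs m \<union> B \<times> {None}"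
  define v where "v z c = tp m (bump (snd z) (\<lambda>k b. c (fst z, k, b)))"
    for z :: "'a \<times> (nat \<times> (2 \<Rightarrow> complex)) option" and c :: "'a \<times> nat \<times> 2 \<Rightarrow> complex"
  define c0 where "c0 = (\<lambda>(j, k, b). X j k b)"
  have v: "(\<lambda>c. v z c \<alpha>) \<in> polyfun" for z \<alpha>
    unfolding v_def by (intro polyfun_tp_bump polyfun.var)
  have iff: "fills m A B (\<lambda>j k b. c (j, k, b)) \<longleftrightarrow> separating (idx m) ((\<lambda>z. v z c) ` I)" for c
    unfolding fills_iff_separating v_def I_def case_prod_unfold ..
  have "separating (idx m) ((\<lambda>z. v z c0) ` I)"
    using assms iff[of c0] by (simp add: c0_def)
  from separating_open[OF finite_idx v this]
  obtain P where P: "P \<in> polyfun" "P c0 \<noteq> 0"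
    "\<forall>c. P c \<noteq> 0 \<longrightarrow> separating (idx m) ((\<lambda>z. v z c) ` I)"
    by (elim bexE conjE)
  show ?thesis
    unfolding iff by (rule genericallyI[OF P(1,2)]) (use P(3) in simp)
qed

text \<open>A form on more factors is a family \<open>\<psi>\<close> of forms indexed by blocks. If the conditions depend
  polynomially on \<open>\<sigma>\<close> and decouple into the blocks at \<open>\<sigma> = 0\<close>, it suffices to solve the problem
  separately in each block; genericity provides a common choice of the points, and then \<open>\<sigma> \<noteq> 0\<close>.\<close>

lemma degenerate_blocks:
  fixes w :: "'i \<Rightarrow> complex \<Rightarrow> 'e::finite \<Rightarrow> complex" and v :: "'i \<times> nat \<Rightarrow> complex \<Rightarrow> 'e \<Rightarrow> complex"
  assumes fin: "finite J" "finite K"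
    and w: "\<And>j \<epsilon>. (\<lambda>c. w j (c ()) \<epsilon>) \<in> polyfun" and v: "\<And>k \<epsilon>. (\<lambda>c. v k (c ()) \<epsilon>) \<in> polyfun"
    and w0: "\<forall>j\<in>J. w j 0 = (\<lambda>\<epsilon>. if \<epsilon> = \<gamma> j then 1 else 0)"
    and v0: "\<forall>k\<in>K. v k 0 = (\<lambda>\<epsilon>. if \<epsilon> = \<delta> k then 1 else 0)"
    and disj: "\<And>\<epsilon>. {j\<in>J. \<gamma> j = \<epsilon>} \<inter> fst ` {k\<in>K. \<delta> k = \<epsilon>} = {}"
    and Fill: "\<And>\<epsilon>. Fill m (card {j\<in>J. \<gamma> j = \<epsilon>}) (card (fst ` {k\<in>K. \<delta> k = \<epsilon>}))"
  shows "\<exists>\<sigma> X. \<sigma> \<noteq> 0 \<and> (\<forall>\<psi>. (\<forall>j\<in>J. \<forall>d\<in>dirs m. (\<Sum>\<epsilon>\<in>UNIV. w j \<sigma> \<epsilon> * ev m (\<psi> \<epsilon>) (bump d (X j))) = 0) \<longrightarrow>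
      (\<forall>k\<in>K. (\<Sum>\<epsilon>\<in>UNIV. v k \<sigma> \<epsilon> * ev m (\<psi> \<epsilon>) (X (fst k))) = 0) \<longrightarrow> (\<forall>\<epsilon>. \<forall>\<alpha>\<in>idx m. \<psi> \<epsilon> \<alpha> = 0))"
proof -
  define A where "A \<epsilon> = {j\<in>J. \<gamma> j = \<epsilon>}" for \<epsilon>
  define B where "B \<epsilon> = fst ` {k\<in>K. \<delta> k = \<epsilon>}" for \<epsilon>
  have "generically (\<lambda>c. fills m (A \<epsilon>) (B \<epsilon>) (\<lambda>j k b. c (j, k, b)))" for \<epsilon>
  proof -
    have "\<exists>X. fills m (A \<epsilon>) (B \<epsilon>) X"
      using fin disj[of \<epsilon>] Fill[of \<epsilon>] by (intro Fill_imp_fills) (auto simp: A_def B_def)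
    then show ?thesis using fills_generically by blast
  qed
  then have "generically (\<lambda>c. \<forall>\<epsilon>\<in>UNIV. fills m (A \<epsilon>) (B \<epsilon>) (\<lambda>j k b. c (j, k, b)))"
    by (intro generically_Ball) simp_all
  from generically_ex[OF this] obtain c where
    c: "\<And>\<epsilon>. fills m (A \<epsilon>) (B \<epsilon>) (\<lambda>j k b. c (j, k, b))" by auto
  define D where "D = (UNIV :: 'e set) \<times> idx m"
  define I where "I = Inl ` (J \<times> dirs m) \<union> Inr ` K"
  \<comment> \<open>The variable \<open>None\<close> carries the parameter \<open>\<sigma>\<close>
    and the variables \<open>Some\<close> carry the coordinates of the points, so that openness is
    applied to both together.\<close>
  define pt where "pt C = (\<lambda>j k b. C (Some (j, k, b)))" for C :: "('i \<times> nat \<times> 2) option \<Rightarrow> complex"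
  define vec where "vec z C = (\<lambda>(\<epsilon>, \<alpha>). case z of
      Inl (j, d) \<Rightarrow> w j (C None) \<epsilon> * tp m (bump d (pt C j)) \<alpha>
    | Inr k \<Rightarrow> v k (C None) \<epsilon> * tp m (pt C (fst k)) \<alpha>)" for z and C :: "('i \<times> nat \<times> 2) option \<Rightarrow> complex"
  have pair: "(\<Sum>x\<in>D. \<Psi> x * vec z C x) = (case z of
      Inl (j, d) \<Rightarrow> (\<Sum>\<epsilon>\<in>UNIV. w j (C None) \<epsilon> * ev m (\<lambda>\<alpha>. \<Psi> (\<epsilon>, \<alpha>)) (bump d (pt C j)))
    | Inr k \<Rightarrow> (\<Sum>\<epsilon>\<in>UNIV. v k (C None) \<epsilon> * ev m (\<lambda>\<alpha>. \<Psi> (\<epsilon>, \<alpha>)) (pt C (fst k))))" for \<Psi> z C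
    unfolding D_def vec_def ev_def sum_distrib_left sum.cartesian_product
    by (auto simp: case_prod_unfold mult_ac split: sum.split prod.split intro!: sum.cong)
  have polw: "(\<lambda>C :: ('i \<times> nat \<times> 2) option \<Rightarrow> complex. w j (C None) \<epsilon>) \<in> polyfun" for j \<epsilon>
    by (rule polyfun_subst[OF w[of j \<epsilon>], of "\<lambda>C _. C None"]) (rule polyfun.var)
  have polv: "(\<lambda>C :: ('i \<times> nat \<times> 2) option \<Rightarrow> complex. v k (C None) \<epsilon>) \<in> polyfun" for k \<epsilon>
    by (rule polyfun_subst[OF v[of k \<epsilon>], of "\<lambda>C _. C None"]) (rule polyfun.var)
  have tpb: "(\<lambda>C. tp m (bump d (pt C j)) \<alpha>) \<in> polyfun" for d j \<alpha>
    unfolding pt_def by (intro polyfun_tp_bump polyfun.var)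
  have tp0: "(\<lambda>C. tp m (pt C j) \<alpha>) \<in> polyfun" for j \<alpha>
    using tpb[of None j \<alpha>] by (simp add: bump_def)
  have vec: "(\<lambda>C. vec z C x) \<in> polyfun" for z x
    unfolding vec_def by (cases x; cases z) (auto intro!: polyfun.mult polw polv tpb tp0 split: prod.split)
  define C0 where "C0 = (\<lambda>z. case z of None \<Rightarrow> 0 | Some z \<Rightarrow> c z)"
  have finD: "finite D" by (simp add: D_def)
  have "separating D ((\<lambda>z. vec z C0) ` I)"
    unfolding separating_def
  proof (intro allI impI ballI)
    fix \<Psi> x assume *: "\<forall>u\<in>(\<lambda>z. vec z C0) ` I. (\<Sum>x\<in>D. \<Psi> x * u x) = 0" and "x \<in> D"
    then obtain \<epsilon> \<alpha> where x: "x = (\<epsilon>, \<alpha>)" "\<alpha> \<in> idx m" by (auto simp: D_def)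
    have pt0: "pt C0 j = (\<lambda>k b. c (j, k, b))" for j by (simp add: pt_def C0_def)
    have "(\<lambda>\<alpha>. \<Psi> (\<epsilon>, \<alpha>)) \<alpha> = 0"
      using c[of \<epsilon>]
    proof (rule fillsD)
      fix j assume "j \<in> A \<epsilon>"
      then have j: "j \<in> J" "\<gamma> j = \<epsilon>" by (auto simp: A_def)
      show "sing m (\<lambda>\<alpha>. \<Psi> (\<epsilon>, \<alpha>)) (\<lambda>k b. c (j, k, b))"
        unfolding sing_def
      proof
        fix d assume "d \<in> dirs m"
        with j have "Inl (j, d) \<in> I" by (auto simp: I_def)
        with * have "(\<Sum>x\<in>D. \<Psi> x * vec (Inl (j, d)) C0 x) = 0" by auto
        then show "ev m (\<lambda>\<alpha>. \<Psi> (\<epsilon>, \<alpha>)) (bump d (\<lambda>k b. c (j, k, b))) = 0"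
          unfolding pair using j
          by (simp add: w0 C0_def[THEN fun_cong, of None] pt0 if_distrib[of "\<lambda>x. x * _"] cong: if_cong)
      qed
    next
      fix j assume "j \<in> B \<epsilon>"
      then obtain k where k: "k \<in> K" "\<delta> k = \<epsilon>" "j = fst k" by (auto simp: B_def)
      then have "Inr k \<in> I" by (auto simp: I_def)
      with * have "(\<Sum>x\<in>D. \<Psi> x * vec (Inr k) C0 x) = 0" by auto
      then show "ev m (\<lambda>\<alpha>. \<Psi> (\<epsilon>, \<alpha>)) (\<lambda>k b. c (j, k, b)) = 0"
        unfolding pair using k
        by (simp add: v0 C0_def[THEN fun_cong, of None] pt0 if_distrib[of "\<lambda>x. x * _"] cong: if_cong)
    qed (fact x(2))
    then show "\<Psi> x = 0" using x by simp
  qed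
  from separating_open[OF finD vec this]
  obtain P where P: "P \<in> polyfun" "P C0 \<noteq> 0"
    "\<forall>C. P C \<noteq> 0 \<longrightarrow> separating D ((\<lambda>z. vec z C) ` I)" by (elim bexE conjE)
  \<comment> \<open>Openness around \<open>C0\<close> could still return the degenerate value 0 of
    the parameter; the coordinate \<open>None\<close> is therefore kept nonzero as a second
    polynomial.\<close>
  have "\<exists>C. P C \<noteq> 0 \<and> C None \<noteq> 0"
    by (rule polyfun_common_nonzero[OF P(1) polyfun.var[of None] P(2), where b = "\<lambda>_. 1"]) simp
  then obtain C where C: "separating D ((\<lambda>z. vec z C) ` I)" "C None \<noteq> 0" using P(3) by auto
  show ?thesis
  proof (intro exI[of _ "C None"] exI[of _ "pt C"] conjI allI impI ballI)
    fix \<psi> \<epsilon> \<alpha>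
    assume J: "\<forall>j\<in>J. \<forall>d\<in>dirs m. (\<Sum>\<epsilon>\<in>UNIV. w j (C None) \<epsilon> * ev m (\<psi> \<epsilon>) (bump d (pt C j))) = 0"
      and K: "\<forall>k\<in>K. (\<Sum>\<epsilon>\<in>UNIV. v k (C None) \<epsilon> * ev m (\<psi> \<epsilon>) (pt C (fst k))) = 0"
      and \<alpha>: "\<alpha> \<in> idx m"
    have "(\<lambda>(\<epsilon>, \<alpha>). \<psi> \<epsilon> \<alpha>) (\<epsilon>, \<alpha>) = 0"
      using C(1)
    proof (rule separatingD)
      fix u assume "u \<in> (\<lambda>z. vec z C) ` I"
      then obtain z where z: "z \<in> I" "u = vec z C" by auto
      show "(\<Sum>x\<in>D. (\<lambda>(\<epsilon>, \<alpha>). \<psi> \<epsilon> \<alpha>) x * u x) = 0"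
        unfolding z(2) pair using z(1) J K by (auto simp: I_def)
    qed (use \<alpha> in \<open>simp add: D_def\<close>)
    then show "\<psi> \<epsilon> \<alpha> = 0" by simp
  qed (fact C(2))
qed

section \<open>Splitting off one factor\<close>

lemma Fill_mono:
  assumes "Fill m t b" "b \<le> b'"
  shows "Fill m t b'"
proof -
  obtain X where "fills m {..<t} {t..<t+b} X" using assms(1) unfolding Fill_def ..
  then have "fills m {..<t} {t..<t+b'} X"
    using fills_reindex[of m "{..<t}" "{t..<t+b}" X id] assms(2) by (simp add: subset_eq)
  then show ?thesis unfolding Fill_def by (rule exI[of _ X])
qed

text \<open>The new vector is the first basis vector for \<open>t0\<close> of the double points and
  the second one for the other \<open>t1\<close>. Each is double for one block and simple for the
  other, whence the crossed counts. No limit is taken: the weights are constant in the parameter,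
  and \<open>degenerate_blocks\<close> only provides points common to both blocks.\<close>

lemma Fill_split:
  assumes "Fill m t0 (t1 + b0)" "Fill m t1 (t0 + b1)"
  shows "Fill (Suc m) (t0 + t1) (b0 + b1)"
proof -
  define T0 T1 S0 S1 where "T0 = {..<t0}" and "T1 = {t0..<t0+t1}"
    and "S0 = {t0+t1..<t0+t1+b0}" and "S1 = {t0+t1+b0..<t0+t1+b0+b1}"
  note sets = T0_def T1_def S0_def S1_def
  define \<gamma> where "\<gamma> j = (if j \<in> T0 then 1 else 2 :: 2)" for j
  define \<delta> where "\<delta> j = (if j \<in> T1 \<union> S0 then 1 else 2 :: 2)" for j
  define J where "J = T0 \<union> T1"
  \<comment> \<open>Here every point carries at most one simple condition, so the number that
    distinguishes several of them is always 0.\<close>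
  define K where "K = (\<lambda>j. (j, 0 :: nat)) ` (T0 \<union> T1 \<union> S0 \<union> S1)"
  define ind where "ind e \<epsilon> = (if \<epsilon> = e then 1 else 0 :: complex)" for e \<epsilon> :: 2
  have fin: "finite J" "finite K" by (simp_all add: J_def K_def sets)
  have J: "{j\<in>J. \<gamma> j = \<epsilon>} = (if \<epsilon> = 1 then T0 else T1)" for \<epsilon>
    using exhaust_2[of \<epsilon>] by (auto simp: J_def \<gamma>_def sets)
  have K: "fst ` {k\<in>K. \<delta> (fst k) = \<epsilon>} = (if \<epsilon> = 1 then T1 \<union> S0 else T0 \<union> S1)" for \<epsilon>
    using exhaust_2[of \<epsilon>] by (auto simp: K_def \<delta>_def sets image_iff)
  have disj: "{j\<in>J. \<gamma> j = \<epsilon>} \<inter> fst ` {k\<in>K. \<delta> (fst k) = \<epsilon>} = {}" for \<epsilon>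
    unfolding J K by (auto simp: sets)
  have "card (T1 \<union> S0) = t1 + b0" "card (T0 \<union> S1) = t0 + b1"
    by (subst card_Un_disjoint; force simp: sets)+
  moreover have "card T0 = t0" "card T1 = t1" by (simp_all add: sets)
  ultimately have "Fill m (card {j\<in>J. \<gamma> j = \<epsilon>}) (card (fst ` {k\<in>K. \<delta> (fst k) = \<epsilon>}))" for \<epsilon>
    using assms unfolding J K by simp
  note Fill = this
  have ind: "ind e = (\<lambda>\<epsilon>. if \<epsilon> = e then 1 else 0)" for e by (simp add: ind_def fun_eq_iff)
  obtain \<sigma> X where X: "\<forall>\<psi>. (\<forall>j\<in>J. \<forall>d\<in>dirs m. (\<Sum>\<epsilon>\<in>UNIV. ind (\<gamma> j) \<epsilon> * ev m (\<psi> \<epsilon>) (bump d (X j))) = 0) \<longrightarrow>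
      (\<forall>k\<in>K. (\<Sum>\<epsilon>\<in>UNIV. ind (\<delta> (fst k)) \<epsilon> * ev m (\<psi> \<epsilon>) (X (fst k))) = 0) \<longrightarrow> (\<forall>\<epsilon>. \<forall>\<alpha>\<in>idx m. \<psi> \<epsilon> \<alpha> = 0)"
    using degenerate_blocks[where w = "\<lambda>j _. ind (\<gamma> j)" and v = "\<lambda>k _. ind (\<delta> (fst k))" and \<gamma> = \<gamma>
        and \<delta> = "\<lambda>k. \<delta> (fst k)", OF fin polyfun.const polyfun.const ballI[OF ind] ballI[OF ind] disj Fill]
    by (elim exE conjE)
  define Y where "Y j = case_nat (ind (if j \<in> J then \<gamma> j else \<delta> j)) (X j)" for j
  have "fills (Suc m) J (S0 \<union> S1) Y"
  proof (rule fillsI)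
    fix \<phi> \<alpha>
    assume T: "\<And>j. j \<in> J \<Longrightarrow> sing (Suc m) \<phi> (Y j)"
      and S: "\<And>j. j \<in> S0 \<union> S1 \<Longrightarrow> ev (Suc m) \<phi> (Y j) = 0" and "\<alpha> \<in> idx (Suc m)"
    then obtain b \<alpha>' where \<alpha>: "\<alpha> = b # \<alpha>'" "\<alpha>' \<in> idx m" by (auto simp: idx_def length_Suc_conv)
    have sing: "sing (Suc m) \<phi> (case_nat (ind (\<gamma> j)) (X j))" if "j \<in> J" for j
      using T[OF that] that by (simp add: Y_def)
    have "\<forall>b. \<forall>\<alpha>\<in>idx m. \<phi> (b # \<alpha>) = 0"
    proof (rule X[THEN spec, THEN mp, THEN mp, of "\<lambda>b \<alpha>. \<phi> (b # \<alpha>)"]; intro ballI)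
      fix j d assume "j \<in> J" "d \<in> dirs m"
      then show "(\<Sum>\<epsilon>\<in>UNIV. ind (\<gamma> j) \<epsilon> * ev m (\<lambda>\<alpha>. \<phi> (\<epsilon> # \<alpha>)) (bump d (X j))) = 0"
        using sing_cons(1)[OF sing] by blast
    next
      fix k assume "k \<in> K"
      then obtain j where j: "k = (j, 0)" "j \<in> J \<or> j \<in> S0 \<union> S1" by (auto simp: K_def J_def)
      show "(\<Sum>\<epsilon>\<in>UNIV. ind (\<delta> (fst k)) \<epsilon> * ev m (\<lambda>\<alpha>. \<phi> (\<epsilon> # \<alpha>)) (X (fst k))) = 0"
      proof (cases "j \<in> J")
        case True
        then show ?thesis using sing_cons(2)[OF sing] j(1) by simp
      next
        case False
        then show ?thesis using S[of j] j unfolding Y_def ev_cons by simp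
      qed
    qed
    then show "\<phi> \<alpha> = 0" using \<alpha> by simp
  qed
  moreover have "card J = t0 + t1" "card (S0 \<union> S1) = b0 + b1"
    unfolding J_def by (subst card_Un_disjoint; force simp: sets)+
  ultimately show ?thesis
    by (intro fills_imp_Fill[of _ J "S0 \<union> S1" Y]) (auto simp: J_def sets)
qed

lemma Fill_0: "t + b > 0 \<Longrightarrow> Fill 0 t b"
  unfolding Fill_def
proof (intro exI[of _ undefined] fillsI)
  fix \<phi> :: tensor and \<alpha>
  assume "t + b > 0" and sing: "\<And>j. j \<in> {..<t} \<Longrightarrow> sing 0 \<phi> (undefined j)"
    and ev: "\<And>j. j \<in> {t..<t + b} \<Longrightarrow> ev 0 \<phi> (undefined j) = 0" and "\<alpha> \<in> idx 0"
  have "\<exists>x. ev 0 \<phi> x = 0"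
  proof (cases "t > 0")
    case True
    then show ?thesis using sing[of 0] unfolding sing_def by (auto simp: dirs_def)
  next
    case False
    then show ?thesis using \<open>t + b > 0\<close> ev[of t] by auto
  qed
  then show "\<phi> \<alpha> = 0" using \<open>\<alpha> \<in> idx 0\<close> by (simp add: ev_def tp_def)
qed

section \<open>Degenerating two factors at once\<close>

definition quad :: "'b \<Rightarrow> 'b \<Rightarrow> 'b \<Rightarrow> 'b \<Rightarrow> 2 \<times> 2 \<Rightarrow> 'b" where
  "quad a b c d = (\<lambda>(i, j). if i = 1 then (if j = 1 then a else b) else (if j = 1 then c else d))"

definition duo :: "'b \<Rightarrow> 'b \<Rightarrow> 2 \<Rightarrow> 'b" where
  "duo a b = (\<lambda>i. if i = 1 then a else b)"

lemma sum_quad: "(\<Sum>\<epsilon>\<in>UNIV. quad a b c d \<epsilon> * f \<epsilon>) = a * f (1, 1) + b * f (1, 2) + c * f (2, 1) + d * (f (2, 2) :: complex)"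
proof -
  have "(\<Sum>\<epsilon>\<in>UNIV. quad a b c d \<epsilon> * f \<epsilon>) = (\<Sum>(i,j)\<in>UNIV \<times> UNIV. quad a b c d (i, j) * f (i, j))"
    by (simp add: case_prod_unfold)
  also have "\<dots> = (\<Sum>i\<in>UNIV. \<Sum>j\<in>UNIV. quad a b c d (i, j) * f (i, j))"
    by (simp add: sum.cartesian_product)
  finally show ?thesis by (simp add: sum_2 quad_def)
qed

lemma quad_ind:
  "quad 1 0 0 0 = (\<lambda>\<epsilon>. if \<epsilon> = (1, 1) then 1 else 0 :: complex)"
  "quad 0 1 0 0 = (\<lambda>\<epsilon>. if \<epsilon> = (1, 2) then 1 else 0 :: complex)"
  "quad 0 0 1 0 = (\<lambda>\<epsilon>. if \<epsilon> = (2, 1) then 1 else 0 :: complex)"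
  "quad 0 0 0 1 = (\<lambda>\<epsilon>. if \<epsilon> = (2, 2) then 1 else 0 :: complex)"
  unfolding quad_def fun_eq_iff
  by (auto simp: split_paired_all) (metis exhaust_2)+

text \<open>The last four equations say that the 2 x 2 matrix of block values at \<open>x\<close> is
  annihilated by the new vectors, one from each side.\<close>

lemma sing_cons2:
  assumes "sing (Suc (Suc m)) \<phi> (case_nat (duo a b) (case_nat (duo a' b') x))"
  defines "E \<equiv> \<lambda>i j y. ev m (\<lambda>\<alpha>. \<phi> (i # j # \<alpha>)) y"
  shows "d \<in> dirs m \<Longrightarrow> a * a' * E 1 1 (bump d x) + a * b' * E 1 2 (bump d x) +
      b * a' * E 2 1 (bump d x) + b * b' * E 2 2 (bump d x) = 0"
    and "a' * E 1 1 x + b' * E 1 2 x = 0" "a' * E 2 1 x + b' * E 2 2 x = 0"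
    and "a * E 1 1 x + b * E 2 1 x = 0" "a * E 1 2 x + b * E 2 2 x = 0"
proof -
  show "a * a' * E 1 1 (bump d x) + a * b' * E 1 2 (bump d x) +
      b * a' * E 2 1 (bump d x) + b * b' * E 2 2 (bump d x) = 0" if d: "d \<in> dirs m"
  proof -
    have "map_option (map_prod Suc id) d \<in> dirs (Suc m)"
      using d by (auto simp: dirs_def image_iff)
    from sing_cons(1)[OF assms(1) this] show ?thesis
      by (simp add: bump_cons[symmetric] ev_cons sum_2 duo_def E_def algebra_simps)
  qed
  show "a' * E 1 1 x + b' * E 1 2 x = 0" "a' * E 2 1 x + b' * E 2 2 x = 0"
    using sing_cons(2)[OF assms(1), of "duo 1 0"] sing_cons(2)[OF assms(1), of "duo 0 1"]
    by (simp_all add: ev_cons sum_2 duo_def E_def)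
  have *: "(\<Sum>i\<in>UNIV. duo a b i * ev (Suc m) (\<lambda>\<alpha>. \<phi> (i # \<alpha>)) (case_nat u x)) = 0" for u
  proof -
    have "Some (0, u) \<in> dirs (Suc m)" by (simp add: dirs_def)
    moreover have "bump (Some (0, u)) (case_nat (duo a' b') x) = case_nat u x"
      by (simp add: bump_def fun_eq_iff split: nat.split)
    ultimately show ?thesis using sing_cons(1)[OF assms(1), of "Some (0, u)"] by simp
  qed
  show "a * E 1 1 x + b * E 2 1 x = 0" "a * E 1 2 x + b * E 2 2 x = 0"
    using *[of "duo 1 0"] *[of "duo 0 1"] by (simp_all add: ev_cons sum_2 duo_def E_def)
qed

lemma less_8_cases:
  assumes "(k::nat) < 8"
  shows "k = 0 \<or> k = 1 \<or> k = 2 \<or> k = 3 \<or> k = 4 \<or> k = 5 \<or> k = 6 \<or> k = 7"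
  using assms by arith

lemma sum_less_8: "(\<Sum>k<8::nat. f k) = f 0 + f 1 + f 2 + f 3 + f 4 + f 5 + f 6 + (f 7 :: nat)"
  by (simp add: eval_nat_numeral)

lemma polyfun_quad:
  assumes "a \<in> polyfun" "b \<in> polyfun" "c \<in> polyfun" "d \<in> polyfun"
  shows "(\<lambda>x. quad (a x) (b x) (c x) (d x) \<epsilon>) \<in> polyfun"
  using assms by (cases "fst \<epsilon> = 1"; cases "snd \<epsilon> = 1") (simp_all add: quad_def case_prod_unfold)

text \<open>
  Types of points, by their blocks in \<open>{1, 2} \<times> {1, 2}\<close>: \<open>p\<close> is double at \<open>(1,1)\<close> or \<open>(2,2)\<close> and simple
  at the two adjacent blocks; \<open>q\<close> is double at \<open>(1,2)\<close> or \<open>(2,1)\<close> and simple at the two adjacent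
  blocks; \<open>x\<close> is double at \<open>(1,1)\<close> or \<open>(2,2)\<close> and simple at the opposite block and at one adjacent
  block. A point of type \<open>x\<close> at \<open>(1,1)\<close> has first coordinates \<open>(1, \<sigma>\<^sup>2)\<close> and \<open>(1, \<sigma>)\<close> or vice versa;
  the forms on the blocks \<open>(1,2)\<close>, \<open>(2,1)\<close> are divided by \<open>\<sigma>\<^sup>2\<close> before \<open>\<sigma>\<close> tends to \<open>0\<close>. The lists
  below treat the eight types in the order of the sum in the conclusion.
\<close>

lemma Fill_four_blocks:
  assumes "Fill m (p0 + x00 + x01) (q0 + q1 + x10 + x11)"
    and "Fill m (p1 + x10 + x11) (q0 + q1 + x00 + x01)"
    and "Fill m q0 (p0 + p1 + x00 + x10)"
    and "Fill m q1 (p0 + p1 + x01 + x11)"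
  shows "Fill (Suc (Suc m)) (p0 + p1 + q0 + q1 + x00 + x01 + x10 + x11) 0"
proof -
  define cnt where "cnt = (!) [p0, p1, q0, q1, x00, x01, x10, x11]"
  define g :: "nat \<Rightarrow> 2 \<times> 2" where
    "g = (!) [(1,1), (2,2), (1,2), (2,1), (1,1), (1,1), (2,2), (2,2)]"
  define dd :: "nat \<times> nat \<Rightarrow> 2 \<times> 2" where
    "dd = (\<lambda>(t, l). if l = 0 then [(1,2), (1,2), (1,1), (1,1), (2,2), (2,2), (1,1), (1,1)] ! t
      else [(2,1), (2,1), (2,2), (2,2), (1,2), (2,1), (1,2), (2,1)] ! t)"
  \<comment> \<open>For type \<open>x\<close> these are the products of the new coordinates, times
    \<open>s^2\<close> in the blocks (1,2) and (2,1) to undo the division of the forms there. For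
    example, (1, s^2) and (1, s) give 1, s, s^2, s^3 and hence 1, s^3, s^4, s^3.\<close>
  define W :: "nat \<Rightarrow> complex \<Rightarrow> 2 \<times> 2 \<Rightarrow> complex" where
    "W t s = [quad 1 0 0 0, quad 0 0 0 1, quad 0 1 0 0, quad 0 0 1 0,
      quad 1 (s^3) (s^4) (s^3), quad 1 (s^4) (s^3) (s^3), quad (s^3) (s^3) (s^4) 1, quad (s^3) (s^4) (s^3) 1] ! t" for t s
  \<comment> \<open>Take the first type \<open>x\<close>. The matrix equations give E21 = - s E22
    and E12 = - s^2 E22. In the rescaled forms these read s \<psi>21 + \<psi>22 = 0 and, after
    eliminating \<psi>22, \<psi>12 - s \<psi>21 = 0. Their limits are simple conditions at the
    opposite block and at one adjacent block.\<close>
  define V0 :: "nat \<Rightarrow> complex \<Rightarrow> 2 \<times> 2 \<Rightarrow> complex" where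
    "V0 t s = [quad 0 1 0 0, quad 0 1 0 0, quad 1 0 0 0, quad 1 0 0 0,
      quad 0 0 s 1, quad 0 s 0 1, quad 1 0 s 0, quad 1 s 0 0] ! t" for t s
  define V1 :: "nat \<Rightarrow> complex \<Rightarrow> 2 \<times> 2 \<Rightarrow> complex" where
    "V1 t s = [quad 0 0 1 0, quad 0 0 1 0, quad 0 0 0 1, quad 0 0 0 1,
      quad 0 1 (-s) 0, quad 0 (-s) 1 0, quad 0 1 (-s) 0, quad 0 (-s) 1 0] ! t" for t s
  define U :: "nat \<Rightarrow> complex \<Rightarrow> 2 \<Rightarrow> complex" where
    "U t s = [duo 1 0, duo 0 1, duo 1 0, duo 0 1, duo 1 (s^2), duo 1 s, duo s 1, duo (s^2) 1] ! t" for t s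
  define U' :: "nat \<Rightarrow> complex \<Rightarrow> 2 \<Rightarrow> complex" where
    "U' t s = [duo 1 0, duo 0 1, duo 0 1, duo 1 0, duo 1 s, duo 1 (s^2), duo (s^2) 1, duo s 1] ! t" for t s
  define J where "J = (SIGMA t:{..<8}. {..<cnt t})"
  define K where "K = J \<times> {0, 1::nat}"
  \<comment> \<open>List entries from position 8 on are unspecified; types out of range are sent to
    type 0 so that polynomial dependence holds for every index.\<close>
  define w where "w = (\<lambda>j :: nat \<times> nat. W (if fst j < 8 then fst j else 0))"
  define v where "v = (\<lambda>k :: (nat \<times> nat) \<times> nat. let t = (if fst (fst k) < 8 then fst (fst k) else 0) in
    if snd k = 0 then V0 t else V1 t)"
  define \<gamma> where "\<gamma> = (\<lambda>j :: nat \<times> nat. g (fst j))"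
  define \<delta> where "\<delta> = (\<lambda>k :: (nat \<times> nat) \<times> nat. dd (fst (fst k), snd k))"
  have fin: "finite J" "finite K" by (simp_all add: J_def K_def)
  have s: "(\<lambda>c. c ()) \<in> polyfun" by (rule polyfun.var)
  have sk: "(\<lambda>c. c () ^ k) \<in> polyfun" for k by (intro polyfun_power s)
  have sm: "(\<lambda>c. - c ()) \<in> polyfun" using polyfun_diff[OF polyfun.const[of 0] s] by simp
  have pw: "(\<lambda>c. w j (c ()) \<epsilon>) \<in> polyfun" for j \<epsilon>
  proof -
    have "(\<lambda>c. W t (c ()) \<epsilon>) \<in> polyfun" if "t < 8" for t
      using less_8_cases[OF that] unfolding W_def
      by (elim disjE) (simp_all add: polyfun_quad polyfun.const s sk)
    then show ?thesis by (simp add: w_def)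
  qed
  have pv: "(\<lambda>c. v k (c ()) \<epsilon>) \<in> polyfun" for k \<epsilon>
  proof -
    have "(\<lambda>c. V0 t (c ()) \<epsilon>) \<in> polyfun \<and> (\<lambda>c. V1 t (c ()) \<epsilon>) \<in> polyfun" if "t < 8" for t
      using less_8_cases[OF that] unfolding V0_def V1_def
      by (elim disjE) (simp_all add: polyfun_quad polyfun.const s sm)
    then show ?thesis by (simp add: v_def Let_def)
  qed
  have w0: "\<forall>j\<in>J. w j 0 = (\<lambda>\<epsilon>. if \<epsilon> = \<gamma> j then 1 else 0)"
  proof
    fix j assume "j \<in> J"
    then have "fst j < 8" by (auto simp: J_def)
    with less_8_cases[OF this] show "w j 0 = (\<lambda>\<epsilon>. if \<epsilon> = \<gamma> j then 1 else 0)"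
      unfolding w_def \<gamma>_def W_def g_def by (elim disjE) (simp_all add: quad_ind)
  qed
  have v0: "\<forall>k\<in>K. v k 0 = (\<lambda>\<epsilon>. if \<epsilon> = \<delta> k then 1 else 0)"
  proof
    fix k assume "k \<in> K"
    then have "fst (fst k) < 8" "snd k = 0 \<or> snd k = 1" by (auto simp: J_def K_def)
    with less_8_cases[OF this(1)] show "v k 0 = (\<lambda>\<epsilon>. if \<epsilon> = \<delta> k then 1 else 0)"
      unfolding v_def \<delta>_def V0_def V1_def dd_def Let_def by (elim disjE) (simp_all add: quad_ind)
  qed
  have J: "{j\<in>J. \<gamma> j = \<epsilon>} = (SIGMA t:{t\<in>{..<8}. g t = \<epsilon>}. {..<cnt t})" for \<epsilon>
    by (auto simp: J_def \<gamma>_def)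
  have K: "fst ` {k\<in>K. \<delta> k = \<epsilon>} = (SIGMA t:{t\<in>{..<8}. dd (t, 0) = \<epsilon> \<or> dd (t, 1) = \<epsilon>}. {..<cnt t})" for \<epsilon>
    unfolding K_def J_def \<delta>_def by force
  have "dd (t, 0) \<noteq> g t \<and> dd (t, 1) \<noteq> g t" if "t < 8" for t
    using less_8_cases[OF that] unfolding dd_def g_def by (elim disjE) simp_all
  then have disj: "{j\<in>J. \<gamma> j = \<epsilon>} \<inter> fst ` {k\<in>K. \<delta> k = \<epsilon>} = {}" for \<epsilon>
    unfolding J K by auto
  have card: "card (SIGMA t:{t\<in>{..<8}. P t}. {..<cnt t}) = (\<Sum>t<8. if P t then cnt t else 0)" for P
    by (simp add: card_SigmaI sum.inter_filter[symmetric])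
  have Fill: "Fill m (card {j\<in>J. \<gamma> j = \<epsilon>}) (card (fst ` {k\<in>K. \<delta> k = \<epsilon>}))" for \<epsilon>
  proof -
    have "\<epsilon> = (1,1) \<or> \<epsilon> = (1,2) \<or> \<epsilon> = (2,1) \<or> \<epsilon> = (2,2)"
      using exhaust_2[of "fst \<epsilon>"] exhaust_2[of "snd \<epsilon>"] by (cases \<epsilon>) auto
    then show ?thesis
      using assms unfolding J K card sum_less_8
      by (elim disjE) (simp_all add: g_def dd_def cnt_def add_ac)
  qed
  obtain s X where s: "s \<noteq> 0" and X: "\<forall>\<psi>. (\<forall>j\<in>J. \<forall>d\<in>dirs m. (\<Sum>\<epsilon>\<in>UNIV. w j s \<epsilon> * ev m (\<psi> \<epsilon>) (bump d (X j))) = 0) \<longrightarrow>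
      (\<forall>k\<in>K. (\<Sum>\<epsilon>\<in>UNIV. v k s \<epsilon> * ev m (\<psi> \<epsilon>) (X (fst k))) = 0) \<longrightarrow> (\<forall>\<epsilon>. \<forall>\<alpha>\<in>idx m. \<psi> \<epsilon> \<alpha> = 0)"
    using degenerate_blocks[where w = w and v = v and \<gamma> = \<gamma> and \<delta> = \<delta>, OF fin pw pv w0 v0 disj Fill]
    by (elim exE conjE)
  define Y where "Y j = case_nat (U (fst j) s) (case_nat (U' (fst j) s) (X j))" for j
  have "fills (Suc (Suc m)) J {} Y"
  proof (rule fillsI)
    fix \<phi> \<alpha>
    assume T: "\<And>j. j \<in> J \<Longrightarrow> sing (Suc (Suc m)) \<phi> (Y j)" and "\<alpha> \<in> idx (Suc (Suc m))"
    then obtain b b' \<alpha>' where \<alpha>: "\<alpha> = b # b' # \<alpha>'" "\<alpha>' \<in> idx m" by (auto simp: idx_def length_Suc_conv)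
    define E where "E i j y = ev m (\<lambda>\<alpha>. \<phi> (i # j # \<alpha>)) y" for i j y
    \<comment> \<open>The rescaled form; it determines \<open>\<phi>\<close> again because
      \<open>s\<close> is nonzero.\<close>
    define \<psi> where "\<psi> \<epsilon> \<alpha> = quad 1 (1 / s^2) (1 / s^2) 1 \<epsilon> * \<phi> (fst \<epsilon> # snd \<epsilon> # \<alpha>)" for \<epsilon> \<alpha>
    have \<psi>: "ev m (\<psi> (1,1)) y = E 1 1 y" "ev m (\<psi> (1,2)) y = E 1 2 y / s^2"
      "ev m (\<psi> (2,1)) y = E 2 1 y / s^2" "ev m (\<psi> (2,2)) y = E 2 2 y" for y
      by (simp_all add: \<psi>_def[abs_def] quad_def E_def ev_def sum_divide_distrib)
    have "\<forall>\<epsilon>. \<forall>\<alpha>\<in>idx m. \<psi> \<epsilon> \<alpha> = 0"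
    proof (rule X[THEN spec, THEN mp, THEN mp]; intro ballI)
      fix j d assume j: "j \<in> J" and d: "d \<in> dirs m"
      from j have t: "fst j < 8" by (auto simp: J_def)
      define y where "y = bump d (X j)"
      have sc: "a * a' * E 1 1 y + a * b' * E 1 2 y + b * a' * E 2 1 y + b * b' * E 2 2 y = 0"
        if "U (fst j) s = duo a b" "U' (fst j) s = duo a' b'" for a b a' b'
        using sing_cons2(1)[of m \<phi> a b a' b' "X j" d] T[OF j] d that by (simp add: Y_def y_def E_def)
      obtain q where q: "s^2 = q" by simp
      then have s34: "s^3 = s * q" "s^4 = q * q" "q \<noteq> 0" using s by (auto simp: eval_nat_numeral)
      have "(\<Sum>\<epsilon>\<in>UNIV. W (fst j) s \<epsilon> * ev m (\<psi> \<epsilon>) y) = 0"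
        using less_8_cases[OF t]
      proof (elim disjE)
        assume t: "fst j = 0"
        show ?thesis using sc[of 1 0 1 0] s unfolding t U_def U'_def W_def
          by (simp add: sum_quad \<psi>)
      next
        assume t: "fst j = 1"
        show ?thesis using sc[of 0 1 0 1] s unfolding t U_def U'_def W_def
          by (simp add: sum_quad \<psi>)
      next
        assume t: "fst j = 2"
        show ?thesis using sc[of 1 0 0 1] s unfolding t U_def U'_def W_def
          by (simp add: sum_quad \<psi>)
      next
        assume t: "fst j = 3"
        show ?thesis using sc[of 0 1 1 0] s unfolding t U_def U'_def W_def
          by (simp add: sum_quad \<psi>)
      next
        assume t: "fst j = 4"
        show ?thesis using sc[of 1 "s^2" 1 s] s34(3) unfolding t U_def U'_def W_def q
          by (simp add: sum_quad \<psi> q s34(1,2); simp add: mult_ac add_ac)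
      next
        assume t: "fst j = 5"
        show ?thesis using sc[of 1 s 1 "s^2"] s34(3) unfolding t U_def U'_def W_def q
          by (simp add: sum_quad \<psi> q s34(1,2); simp add: mult_ac add_ac)
      next
        assume t: "fst j = 6"
        show ?thesis using sc[of s 1 "s^2" 1] s34(3) unfolding t U_def U'_def W_def q
          by (simp add: sum_quad \<psi> q s34(1,2); simp add: mult_ac add_ac)
      next
        assume t: "fst j = 7"
        show ?thesis using sc[of "s^2" 1 s 1] s34(3) unfolding t U_def U'_def W_def q
          by (simp add: sum_quad \<psi> q s34(1,2); simp add: mult_ac add_ac)
      qed
      then show "(\<Sum>\<epsilon>\<in>UNIV. w j s \<epsilon> * ev m (\<psi> \<epsilon>) (bump d (X j))) = 0"
        using t by (simp add: w_def y_def)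
    next
      fix k assume k: "k \<in> K"
      show "(\<Sum>\<epsilon>\<in>UNIV. v k s \<epsilon> * ev m (\<psi> \<epsilon>) (X (fst k))) = 0"
      proof -
        from k obtain j l where j: "k = (j, l)" "j \<in> J" "l = 0 \<or> l = 1" by (auto simp: K_def)
        then have t: "fst j < 8" by (auto simp: J_def)
        define x where "x = X j"
        have sc: "a' * E 1 1 x + b' * E 1 2 x = 0 \<and> a' * E 2 1 x + b' * E 2 2 x = 0 \<and>
            a * E 1 1 x + b * E 2 1 x = 0 \<and> a * E 1 2 x + b * E 2 2 x = 0"
          if "U (fst j) s = duo a b" "U' (fst j) s = duo a' b'" for a b a' b'
          using sing_cons2(2-5)[of m \<phi> a b a' b' x] T[OF j(2)] that by (simp add: Y_def x_def E_def)
        have "(\<Sum>\<epsilon>\<in>UNIV. V0 (fst j) s \<epsilon> * ev m (\<psi> \<epsilon>) x) = 0 \<and> (\<Sum>\<epsilon>\<in>UNIV. V1 (fst j) s \<epsilon> * ev m (\<psi> \<epsilon>) x) = 0"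
          using less_8_cases[OF t]
        proof (elim disjE)
          assume t: "fst j = 0"
          note 2 = sc[of 1 0 1 0, unfolded t U_def U'_def, simplified]
          show ?thesis unfolding t V0_def V1_def by (simp add: sum_quad \<psi> 2)
        next
          assume t: "fst j = 1"
          note 2 = sc[of 0 1 0 1, unfolded t U_def U'_def, simplified]
          show ?thesis unfolding t V0_def V1_def by (simp add: sum_quad \<psi> 2)
        next
          assume t: "fst j = 2"
          note 2 = sc[of 1 0 0 1, unfolded t U_def U'_def, simplified]
          show ?thesis unfolding t V0_def V1_def by (simp add: sum_quad \<psi> 2)
        next
          assume t: "fst j = 3"
          note 2 = sc[of 0 1 1 0, unfolded t U_def U'_def, simplified]
          show ?thesis unfolding t V0_def V1_def by (simp add: sum_quad \<psi> 2)
        next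
          assume t: "fst j = 4"
          note 2 = sc[of 1 "s^2" 1 s, unfolded t U_def U'_def, simplified]
          then have "E 2 1 x = - (s * E 2 2 x)" "E 1 2 x = - (s^2 * E 2 2 x)"
            by (simp_all add: eq_neg_iff_add_eq_0 add.commute)
          then show ?thesis unfolding t V0_def V1_def using s
            by (simp add: sum_quad \<psi>; simp add: field_simps power2_eq_square)
        next
          assume t: "fst j = 5"
          note 2 = sc[of 1 s 1 "s^2", unfolded t U_def U'_def, simplified]
          then have "E 1 2 x = - (s * E 2 2 x)" "E 2 1 x = - (s^2 * E 2 2 x)"
            by (simp_all add: eq_neg_iff_add_eq_0 add.commute)
          then show ?thesis unfolding t V0_def V1_def using s
            by (simp add: sum_quad \<psi>; simp add: field_simps power2_eq_square)
        next
          assume t: "fst j = 6"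
          note 2 = sc[of s 1 "s^2" 1, unfolded t U_def U'_def, simplified]
          then have "E 2 1 x = - (s * E 1 1 x)" "E 1 2 x = - (s^2 * E 1 1 x)"
            by (simp_all add: eq_neg_iff_add_eq_0 add.commute)
          then show ?thesis unfolding t V0_def V1_def using s
            by (simp add: sum_quad \<psi>; simp add: field_simps power2_eq_square)
        next
          assume t: "fst j = 7"
          note 2 = sc[of "s^2" 1 s 1, unfolded t U_def U'_def, simplified]
          then have "E 1 2 x = - (s * E 1 1 x)" "E 2 1 x = - (s^2 * E 1 1 x)"
            by (simp_all add: eq_neg_iff_add_eq_0 add.commute)
          then show ?thesis unfolding t V0_def V1_def using s
            by (simp add: sum_quad \<psi>; simp add: field_simps power2_eq_square)
        qed
        then show ?thesis using j t by (auto simp: v_def x_def)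
      qed
    qed
    then have "\<psi> (b, b') \<alpha>' = 0" using \<alpha>(2) by blast
    then show "\<phi> \<alpha> = 0" using s by (simp add: \<alpha>(1) \<psi>_def quad_def split: if_splits)
  qed
  moreover have "card J = p0 + p1 + q0 + q1 + x00 + x01 + x10 + x11"
    by (simp add: J_def card_SigmaI sum_less_8, simp add: cnt_def)
  ultimately show ?thesis
    by (intro fills_imp_Fill[of _ J "{}" Y]) (use fin in auto)
qed

section \<open>Filling the space of forms\<close>

lemma power_ge_quadratic:
  "6 \<le> m \<Longrightarrow> (m + 1)\<^sup>2 \<le> (2::nat) ^ m"
  "10 \<le> m \<Longrightarrow> 10 * m * m \<le> (2::nat) ^ m"
proof -
  show "6 \<le> m \<Longrightarrow> (m + 1)\<^sup>2 \<le> (2::nat) ^ m"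
  proof (induction m rule: dec_induct)
    case (step m)
    have "6 * m \<le> m * m" using step.hyps by simp
    moreover have "(Suc m + 1)\<^sup>2 = m * m + 4 * m + 4" "(m + 1)\<^sup>2 = m * m + 2 * m + 1"
      by (simp_all add: power2_eq_square algebra_simps)
    moreover have "(2::nat) ^ Suc m = 2 * 2 ^ m" by simp
    ultimately show ?case using step.IH step.hyps by linarith
  qed simp
  show "10 \<le> m \<Longrightarrow> 10 * m * m \<le> (2::nat) ^ m"
  proof (induction m rule: dec_induct)
    case (step m)
    have "10 * m \<le> m * m" using step.hyps by simp
    moreover have "10 * Suc m * Suc m = 10 * m * m + 20 * m + 10" "10 * m * m = 10 * (m * m)"
      by (simp_all add: algebra_simps)
    moreover have "(2::nat) ^ Suc m = 2 * 2 ^ m" by simp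
    ultimately show ?case using step.IH step.hyps by linarith
  qed simp
qed

text \<open>The double points impose independent conditions, and simple points supply exactly the
  missing number. Rounding \<open>t\<close> up to an even number makes the bound survive halving:
  the larger half satisfies \<open>(m + 2) * t0 \<le> 2 ^ m\<close>, which pays for
  \<open>t0\<close> double points and \<open>t1 \<le> t0\<close> simple ones.\<close>

lemma Fill_independent:
  assumes "t \<le> 1 \<or> (m + 1) * (t + t mod 2) \<le> 2 ^ m"
  shows "(m + 1) * t \<le> 2 ^ m \<and> Fill m t (2 ^ m - (m + 1) * t)"
  using assms
proof (induction m arbitrary: t)
  case 0
  then have "t = 0 \<or> t = 1" by auto
  then show ?case by (auto simp: Fill_0)
next
  case (Suc m)
  define t0 t1 where "t0 = (t + 1) div 2" and "t1 = t div 2"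
  have t: "t = t0 + t1" and t10: "t1 \<le> t0" and t0: "2 * t0 = t + t mod 2"
    and par: "t1 + t1 mod 2 \<le> t0 + t0 mod 2"
  proof -
    have "t = t0 + t1 \<and> t1 \<le> t0 \<and> 2 * t0 = t + t mod 2 \<and> t1 + t1 mod 2 \<le> t0 + t0 mod 2"
    proof (cases "even t")
      case True
      then obtain i where "t = 2 * i" by (rule evenE)
      then show ?thesis by (simp add: t0_def t1_def)
    next
      case False
      then obtain i where "t = 2 * i + 1" by (rule oddE)
      then show ?thesis by (cases "even i") (simp_all add: t0_def t1_def mod_Suc even_iff_mod_2_eq_zero)
    qed
    then show "t = t0 + t1" "t1 \<le> t0" "2 * t0 = t + t mod 2" "t1 + t1 mod 2 \<le> t0 + t0 mod 2"
      by simp_all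
  qed
  have ok: "t0 \<le> 1 \<or> (m + 1) * (t0 + t0 mod 2) \<le> 2 ^ m"
  proof (cases "t0 \<le> 1")
    case False
    then have "\<not> t \<le> 1" using t by linarith
    then have *: "(m + 2) * t0 \<le> 2 ^ m" using Suc.prems \<open>\<not> t \<le> 1\<close> unfolding t0[symmetric] by simp
    show ?thesis
    proof (cases "even t0")
      case True
      then show ?thesis using * by simp
    next
      case odd: False
      then have t03: "t0 \<ge> 3" "t0 mod 2 = 1" using False by presburger+
      \<comment> \<open>Rounding an odd \<open>t0\<close> up costs m + 1 - t0 beyond
        \<open>(m + 2) * t0\<close>. This is no cost at all for \<open>t0 \<ge> m + 1\<close>;
        otherwise the product is at most (m + 1)^2, which \<open>2 ^ m\<close> exceeds or equals
        from m = 6 on.\<close>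
      show ?thesis
      proof (cases "t0 \<ge> m + 1")
        case True
        then show ?thesis using * t03(2) by simp
      next
        case False
        then have "(m + 1) * (t0 + t0 mod 2) \<le> (m + 1) * (m + 1)" using t03(2) by (intro mult_le_mono2) simp
        then have le: "(m + 1) * (t0 + t0 mod 2) \<le> (m + 1)\<^sup>2" by (simp only: power2_eq_square)
        show ?thesis
        proof (cases "m \<ge> 6")
          case True
          then show ?thesis using le power_ge_quadratic(1)[OF True] by linarith
        next
          case False
          then have "m = 0 \<or> m = 1 \<or> m = 2 \<or> m = 3 \<or> m = 4 \<or> m = 5" by arith
          then show ?thesis using * t03 odd
            by (elim disjE) (simp_all, presburger?)
        qed
      qed
    qed
  qed simp
  have ok1: "t1 \<le> 1 \<or> (m + 1) * (t1 + t1 mod 2) \<le> 2 ^ m"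
    using ok t10 mult_le_mono2[OF par, of "m + 1"] by linarith
  have bound: "(m + 1) * t0 + t1 \<le> 2 ^ m"
  proof (cases "t \<le> 1")
    case True
    then have "t1 = 0" "t0 \<le> 1" by (simp_all add: t0_def t1_def)
    then show ?thesis using Suc.IH[of t0] by simp
  next
    case False
    have "(m + 2) * t0 \<le> 2 ^ m" using Suc.prems \<open>\<not> t \<le> 1\<close> unfolding t0[symmetric] by simp
    then show ?thesis using t10 by simp
  qed
  have "(m + 1) * t1 + t0 \<le> (m + 1) * t0 + t1"
  proof -
    have "m * t1 \<le> m * t0" using t10 by simp
    then show ?thesis by (simp add: algebra_simps)
  qed
  with bound have bound1: "(m + 1) * t1 + t0 \<le> 2 ^ m" by linarith
  define b0 b1 where "b0 = 2 ^ m - (m + 1) * t0 - t1" and "b1 = 2 ^ m - (m + 1) * t1 - t0"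
  have "t1 + b0 = 2 ^ m - (m + 1) * t0" "t0 + b1 = 2 ^ m - (m + 1) * t1"
    using bound bound1 unfolding b0_def b1_def by linarith+
  then have "Fill m t0 (t1 + b0)" "Fill m t1 (t0 + b1)"
    using Suc.IH[OF ok] Suc.IH[OF ok1] by simp_all
  then have "Fill (Suc m) t (b0 + b1)" unfolding t by (rule Fill_split)
  moreover have "b0 + b1 = 2 ^ Suc m - (Suc m + 1) * t" "(Suc m + 1) * t \<le> 2 ^ Suc m"
    using bound bound1 unfolding b0_def b1_def t by (simp_all add: algebra_simps)
  ultimately show ?case by simp
qed

lemma Fill_by_count:
  assumes "t \<le> 1 \<or> (m + 1) * (t + t mod 2) \<le> 2 ^ m" "2 ^ m \<le> (m + 1) * t + b"
  shows "Fill m t b"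
  using Fill_independent[OF assms(1)] assms(2) by (auto intro: Fill_mono)

lemma Fill_double: "Fill m h h \<Longrightarrow> Fill (Suc m) (2 * h) 0"
  using Fill_split[of m h h 0 0] by (simp add: mult_2)

text \<open>The solution of the counting problem for \<open>k = n - 1\<close>, \<open>N = 2 ^ (n - 2)\<close> and \<open>s = 2 * h + 1\<close>:
  division with remainder by \<open>k - 2\<close> makes two of the four counts exact.\<close>

lemma four_block_counts:
  fixes k N h :: int
  assumes k: "10 \<le> k" and N: "5 * k * k \<le> N"
    and upper: "(k + 2) * (2 * h) < 4 * N" and lower: "4 * N \<le> (k + 2) * (2 * h + 1)"
  obtains \<alpha> \<beta> \<eta> where "\<alpha> + \<beta> = h" "0 \<le> \<alpha>" "0 \<le> \<beta>" "0 \<le> \<eta>" "N = k * (\<beta> + 1) + 2 * \<alpha> + \<eta>"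
    "\<eta> + k \<le> \<beta> + 1" "k * (\<beta> + 2) \<le> N" "k * (\<alpha> + 1) \<le> N"
proof -
  \<comment> \<open>Substituting \<alpha> = h - \<beta> in the required equation for
    \<open>N\<close> turns it into D = (k - 2) * \<beta> + \<eta>.\<close>
  define D where "D = N - k - 2 * h"
  define \<beta> \<eta> \<alpha> where "\<beta> = D div (k - 2)" and "\<eta> = D mod (k - 2)" and "\<alpha> = h - \<beta>"
  define H where "H = (k + 2) * h"
  have kk: "10 * k \<le> k * k" using k by simp
  have D: "D = (k - 2) * \<beta> + \<eta>" by (simp add: \<beta>_def \<eta>_def)
  have \<eta>: "0 \<le> \<eta>" "\<eta> \<le> k - 3" using k pos_mod_bound[of "k - 2" D] pos_mod_sign[of "k - 2" D]
    unfolding \<eta>_def by linarith+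
  have H: "H < 2 * N" "4 * N \<le> 2 * H + k + 2" using upper lower by (simp_all add: H_def algebra_simps)
  have "0 < H" using H(2) N kk k by linarith
  then have h: "0 < h" using k by (simp add: H_def zero_less_mult_iff)
  have "12 * h \<le> H" using h k unfolding H_def by (intro mult_right_mono) auto
  then have D3: "3 * D \<ge> 2 * N - 3 * k" using H(1) by (simp add: D_def)
  \<comment> \<open>This is what \<eta> + k \<le> \<beta> + 1 demands when the remainder takes its
    largest value k - 3.\<close>
  have \<beta>: "2 * k - 4 \<le> \<beta>"
  proof (rule ccontr)
    assume "\<not> 2 * k - 4 \<le> \<beta>"
    then have "(k - 2) * \<beta> \<le> (k - 2) * (2 * k - 5)" using k by (intro mult_left_mono) auto
    then have "D \<le> (k - 2) * (2 * k - 5) + (k - 3)" using D \<eta> by linarith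
    also have "\<dots> = 2 * (k * k) - 8 * k + 7" by (simp add: algebra_simps)
    finally show False using D3 N kk k by linarith
  qed
  \<comment> \<open>Multiplying by k + 2 replaces \<open>h\<close> by \<open>H\<close>, which lies
    just below 2 * N. So \<open>\<alpha>\<close> is close to N / (k + 2), and the two bounds on it
    follow by estimating \<open>H\<close> and \<open>\<eta>\<close>.\<close>
  have \<alpha>eq: "(k + 2) * (k - 2) * \<alpha> = k * H - (k + 2) * N + (k + 2) * (k + \<eta>)"
  proof -
    have "(k - 2) * \<alpha> = k * h - N + k + \<eta>"
      using D unfolding D_def \<alpha>_def by (simp add: algebra_simps)
    then have "(k + 2) * ((k - 2) * \<alpha>) = (k + 2) * (k * h - N + k + \<eta>)" by simp
    then show ?thesis by (simp add: H_def algebra_simps)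
  qed
  have \<alpha>lo: "N \<le> (k + 2) * \<alpha>"
  proof -
    have "k * (4 * N) \<le> k * (2 * H + k + 2)" using H(2) k by (intro mult_left_mono) auto
    moreover have "0 \<le> (k + 2) * \<eta>" using \<eta> k by simp
    moreover have "2 * (k * H - (k + 2) * N + (k + 2) * (k + \<eta>)) - (k - 2) * N * 2 =
        (k * (2 * H + k + 2) - k * (4 * N)) + 2 * ((k + 2) * \<eta>) + k * k + 2 * k"
      by (simp add: algebra_simps)
    ultimately have "(k - 2) * N * 2 \<le> 2 * ((k + 2) * (k - 2) * \<alpha>)"
      unfolding \<alpha>eq using kk k by linarith
    then have "(k - 2) * N \<le> (k - 2) * ((k + 2) * \<alpha>)" by (simp add: algebra_simps)
    then show ?thesis using k by simp
  qed
  have \<alpha>: "k \<le> \<alpha>"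
  proof (rule ccontr)
    assume "\<not> k \<le> \<alpha>"
    then have "(k + 2) * \<alpha> \<le> (k + 2) * (k - 1)" using k by (intro mult_left_mono) auto
    also have "\<dots> = k * k + k - 2" by (simp add: algebra_simps)
    finally show False using \<alpha>lo N kk k by linarith
  qed
  have Neq: "N = k * (\<beta> + 1) + 2 * \<alpha> + \<eta>"
    using D unfolding D_def \<alpha>_def by (simp add: algebra_simps)
  have "k * (\<alpha> + 1) \<le> N"
  proof (rule ccontr)
    assume "\<not> k * (\<alpha> + 1) \<le> N"
    define Q where "Q = (k + 2) * (k - 2)"
    have Q: "0 < Q" using k by (simp add: Q_def)
    then have "Q * N \<le> Q * (k * (\<alpha> + 1))" using \<open>\<not> _ \<le> N\<close> by (intro mult_left_mono) auto
    also have "\<dots> = k * (Q * \<alpha>) + k * Q" by (simp add: algebra_simps)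
    also have "k * (Q * \<alpha>) \<le> k * ((k - 2) * N + (k + 2) * (2 * k - 3))"
    proof (rule mult_left_mono)
      have "k * H \<le> k * (2 * N)" using H(1) k by (intro mult_left_mono) auto
      moreover have "(k + 2) * \<eta> \<le> (k + 2) * (k - 3)" using \<eta> k by (intro mult_left_mono) auto
      ultimately show "Q * \<alpha> \<le> (k - 2) * N + (k + 2) * (2 * k - 3)"
        unfolding Q_def \<alpha>eq by (simp add: algebra_simps)
    qed (use k in simp)
    finally have "2 * ((k - 2) * N) \<le> k * (k + 2) * (3 * k - 5)"
      by (simp add: Q_def algebra_simps)
    moreover have "(k - 2) * (5 * k * k) \<le> (k - 2) * N" using N k by (intro mult_left_mono) auto
    ultimately have "2 * ((k - 2) * (5 * k * k)) \<le> k * (k + 2) * (3 * k - 5)" by linarith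
    then have "7 * (k * (k * k)) \<le> 21 * (k * k) - 10 * k" by (simp add: algebra_simps)
    moreover have "k * (10 * k) \<le> k * (k * k)" using kk k by (intro mult_left_mono) auto
    ultimately show False using kk k by (simp add: algebra_simps)
  qed
  moreover have "k * (\<beta> + 2) \<le> N" using Neq \<alpha> \<eta> k by (simp add: algebra_simps)
  ultimately show thesis
    using that[of \<alpha> \<beta> \<eta>] \<alpha> \<beta> \<eta> Neq k by (simp add: \<alpha>_def)
qed

text \<open>There are \<open>\<alpha>\<close> double points in each off-diagonal block, and \<beta>
  + 1 and \<beta> in the diagonal ones. The diagonal counts are exact; \<open>n \<ge> 11\<close>
  provides the bound \<open>5 * k * k \<le> N\<close> of the counting problem.\<close>

lemma Fill_odd_large:
  assumes n: "11 \<le> n" and lower: "2 ^ n \<le> (n + 1) * (2 * h + 1)"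
    and upper: "(n + 1) * (2 * h) < 2 ^ n"
  shows "Fill n (2 * h + 1) 0"
proof -
  define k m N where "k = n - 1" and "m = n - 2" and "N = (2::nat) ^ m"
  have n': "n = k + 1" "n = Suc (Suc m)" "k = m + 1" and k: "10 \<le> k" using n by (auto simp: k_def m_def)
  have N4: "2 ^ n = 4 * N" by (simp add: n'(2) N_def)
  have "10 * k * k \<le> 2 ^ k" using power_ge_quadratic(2)[OF k] .
  moreover have "2 ^ k = 2 * N" by (simp add: n'(3) N_def)
  moreover have "10 * k * k = 2 * (5 * k * k)" by simp
  ultimately have N5: "5 * k * k \<le> N" by linarith
  have "(10::int) \<le> int k" "5 * int k * int k \<le> int N"
    "(int k + 2) * (2 * int h) < 4 * int N" "4 * int N \<le> (int k + 2) * (2 * int h + 1)"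
  proof -
    have "(k + 2) * (2 * h) < 4 * N" "4 * N \<le> (k + 2) * (2 * h + 1)"
      using lower upper N4 n'(1) by simp_all
    then have "int ((k + 2) * (2 * h)) < int (4 * N)" "int (4 * N) \<le> int ((k + 2) * (2 * h + 1))"
      by (simp_all only: of_nat_less_iff of_nat_le_iff)
    then show "(int k + 2) * (2 * int h) < 4 * int N" "4 * int N \<le> (int k + 2) * (2 * int h + 1)"
      by (simp_all add: algebra_simps)
    have "int (5 * k * k) \<le> int N" using N5 by (simp only: of_nat_le_iff)
    then show "(10::int) \<le> int k" "5 * int k * int k \<le> int N" using k by simp_all
  qed
  then obtain a b l :: int where abl: "a + b = int h" "0 \<le> a" "0 \<le> b" "0 \<le> l"
    "int N = int k * (b + 1) + 2 * a + l" "l + int k \<le> b + 1" "int k * (b + 2) \<le> int N" "int k * (a + 1) \<le> int N"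
    by (rule four_block_counts)
  obtain \<alpha> \<beta> \<eta> :: nat where "a = int \<alpha>" "b = int \<beta>" "l = int \<eta>"
    using abl(2-4) by (metis nonneg_int_cases)
  note abl = abl[unfolded this]
  have h: "\<alpha> + \<beta> = h" using abl(1) by linarith
  have Neq: "N = k * (\<beta> + 1) + 2 * \<alpha> + \<eta>"
    using abl(5) by (metis (no_types, opaque_lifting) of_nat_1 of_nat_add of_nat_eq_iff of_nat_mult of_nat_numeral)
  have \<eta>: "\<eta> + k \<le> \<beta> + 1" using abl(6) by linarith
  have "int (k * (\<beta> + 2)) \<le> int N" "int (k * (\<alpha> + 1)) \<le> int N" using abl(7,8) by (simp_all add: algebra_simps)
  then have \<beta>: "k * (\<beta> + 2) \<le> N" and \<alpha>: "k * (\<alpha> + 1) \<le> N" by (simp_all only: of_nat_le_iff)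
  have cond: "t \<le> 1 \<or> (m + 1) * (t + t mod 2) \<le> 2 ^ m" if "k * (t + 1) \<le> N" for t
  proof -
    have "k * (t + t mod 2) \<le> k * (t + 1)" by (intro mult_le_mono2) simp
    then show ?thesis using that by (simp add: n'(3) N_def)
  qed
  have c\<beta>: "k * (\<beta> + 1) \<le> N" using Neq by simp
  \<comment> \<open>With \<open>\<eta>\<close> points of type \<open>x\<close> at (2,2), all in the
    role of \<open>x11\<close>, there must be \<eta> + k at (1,1). These are divided so that the
    simple points in the two off-diagonal blocks differ in number by at most one.\<close>
  define p0 p1 x00 x01 where "p0 = \<beta> + 1 - \<eta> - k" and "p1 = \<beta> - \<eta>"
    and "x00 = \<eta> + k div 2" and "x01 = k - k div 2"
  have sums: "p0 + x00 + x01 = \<beta> + 1" "p1 + \<eta> = \<beta>" "x00 + x01 = \<eta> + k" "p0 + p1 + 2 * \<eta> + k = 2 * \<beta> + 1"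
    using \<eta> k by (auto simp: p0_def p1_def x00_def x01_def)
  have count: "2 ^ m \<le> (m + 1) * \<alpha> + (p0 + p1 + x00)"
  proof -
    have "(k + 2) * (2 * h + 1) \<ge> 4 * N" using lower N4 n'(1) by simp
    moreover have "odd k \<Longrightarrow> odd ((k + 2) * (2 * h + 1))" by simp
    \<comment> \<open>The left side is half of the total number of conditions, rounded down. It
      equals \<open>N\<close>, the count of one diagonal block, plus the count of the poorer
      off-diagonal block.\<close>
    ultimately have "(k + 2) * h + 1 + k div 2 \<ge> 2 * N"
    proof (cases "even k")
      case True
      then obtain i where "k = 2 * i" by blast
      with \<open>(k + 2) * (2 * h + 1) \<ge> 4 * N\<close> show ?thesis by (simp add: algebra_simps)
    next
      case False
      then have "(k + 2) * (2 * h + 1) \<noteq> 4 * N" by (metis \<open>odd k \<Longrightarrow> _\<close> dvd_mult2 even_numeral)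
      with \<open>(k + 2) * (2 * h + 1) \<ge> 4 * N\<close> have "(k + 2) * (2 * h + 1) \<ge> 4 * N + 1" by linarith
      moreover obtain i where "k = 2 * i + 1" using False by (rule oddE)
      ultimately show ?thesis by (simp add: algebra_simps)
    qed
    moreover have "(k + 2) * h + 1 + k div 2 = N + (k * \<alpha> + (p0 + p1 + x00))"
      using sums(4) unfolding Neq h[symmetric] x00_def by (simp add: algebra_simps)
    ultimately show ?thesis by (simp add: n'(3) N_def)
  qed
  have "x00 \<le> x01 + \<eta>" by (simp add: x00_def x01_def)
  have "Fill (Suc (Suc m)) (p0 + p1 + \<alpha> + \<alpha> + x00 + x01 + 0 + \<eta>) 0"
  proof (rule Fill_four_blocks)
    show "Fill m (p0 + x00 + x01) (\<alpha> + \<alpha> + 0 + \<eta>)" unfolding sums(1)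
      by (rule Fill_by_count[OF cond]) (use \<beta> Neq in \<open>simp_all add: n'(3) N_def\<close>)
    show "Fill m (p1 + 0 + \<eta>) (\<alpha> + \<alpha> + x00 + x01)"
      unfolding add_0_right sums(2)
      by (rule Fill_by_count[OF cond]) (use c\<beta> Neq sums(3) in \<open>simp_all add: n'(3) N_def algebra_simps\<close>)
    show "Fill m \<alpha> (p0 + p1 + x00 + 0)"
      by (rule Fill_by_count[OF cond]) (use \<alpha> count in simp_all)
    show "Fill m \<alpha> (p0 + p1 + x01 + \<eta>)"
      by (rule Fill_by_count[OF cond]) (use \<alpha> count \<open>x00 \<le> x01 + \<eta>\<close> in simp_all)
  qed
  moreover have "p0 + p1 + \<alpha> + \<alpha> + x00 + x01 + 0 + \<eta> = 2 * h + 1"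
    using sums(3,4) h by linarith
  ultimately show ?thesis using n'(2) by simp
qed

text \<open>For n up to 10 the number \<open>s\<close> is odd only at n = 1 and n = 8; beyond that
  the estimates for large n apply in both parities.\<close>

lemma Fill_generic_rank:
  assumes "1 \<le> n" "2 ^ n \<le> (n + 1) * s" "(n + 1) * s < 2 ^ n + (n + 1)"
  shows "Fill n s 0"
proof (cases "11 \<le> n")
  case True
  show ?thesis
  proof (cases "even s")
    case False
    then obtain h where "s = 2 * h + 1" by (rule oddE)
    with Fill_odd_large[OF True, of h] assms show ?thesis by simp
  next
    case even: True
    then obtain h where h: "s = 2 * h" by (rule evenE)
    obtain m where m: "n = Suc m" using assms(1) by (cases n) auto
    then have "10 \<le> m" using True by simp
    from power_ge_quadratic(2)[OF this] have sq: "20 * m * m \<le> 2 ^ n" by (simp add: m)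
    have mm: "10 * m \<le> m * m" using \<open>10 \<le> m\<close> by simp
    \<comment> \<open>Rounding \<open>h\<close> up to an even number costs at most m + 1 - h beyond
      \<open>(m + 2) * h\<close>, and the upper bound on \<open>s\<close> allows an excess below (m
      + 2) / 2; this inequality absorbs both.\<close>
    have "3 * n \<le> 2 * h"
    proof (rule ccontr)
      assume "\<not> 3 * n \<le> 2 * h"
      then have "(n + 1) * s \<le> (n + 1) * (3 * n)" by (intro mult_le_mono2) (simp add: h)
      then have "20 * m * m \<le> (m + 2) * (3 * (m + 1))" using sq assms(2) by (simp add: m)
      then show False using mm \<open>10 \<le> m\<close> by (simp add: algebra_simps)
    qed
    then have "(m + 1) * (h + 1) \<le> 2 ^ m" using assms(3) by (simp add: h m algebra_simps)
    moreover have "(m + 1) * (h + h mod 2) \<le> (m + 1) * (h + 1)" by (intro mult_le_mono2) simp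
    ultimately have "Fill m h h"
      using assms(2) by (intro Fill_by_count) (auto simp: h m algebra_simps)
    then show ?thesis using Fill_double h m by simp
  qed
next
  case False
  \<comment> \<open>\<open>Fill_by_count\<close> does not reach three double points in four factors,
    the defective case: their 15 conditions have rank only 14 for general points. Three simple
    points instead of one make up for this.\<close>
  have "Fill (Suc 3) (2 + 1) (1 + 2)" by (rule Fill_split) (simp_all add: Fill_by_count)
  then have "Fill 4 3 3" by (simp add: eval_nat_numeral)
  then have "Fill 4 3 (2 + 2)" by (rule Fill_mono) simp
  then have "Fill (Suc 4) (3 + 2) (2 + 3)" by (rule Fill_split) (simp add: Fill_by_count)
  then have "Fill 5 5 5" by (simp add: eval_nat_numeral)
  \<comment> \<open>The blocks (1,1), (2,2), (1,2), (2,1) receive 65, 64, 66 and 66 conditions, each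
    enough for \<open>2 ^ 6\<close> coefficients.\<close>
  have "Fill (Suc (Suc 6)) (1 + 6 + 8 + 8 + 3 + 3 + 0 + 0) 0"
    by (rule Fill_four_blocks) (simp_all add: Fill_by_count)
  then have f8: "Fill 8 29 0" by (simp add: eval_nat_numeral)
  have "n = 1 \<or> n = 2 \<or> n = 3 \<or> n = 4 \<or> n = 5 \<or> n = 6 \<or> n = 7 \<or> n = 8 \<or> n = 9 \<or> n = 10"
    using False assms(1) by arith
  then show ?thesis
  proof (elim disjE)
    assume n: "n = 1" then have "s = 1" using assms by simp
    then show ?thesis using n by (simp add: Fill_by_count)
  next
    assume n: "n = 2" then have "s = 2" using assms by simp
    then show ?thesis using n Fill_double[of 1 1] by (simp add: Fill_by_count numeral_2_eq_2)
  next
    assume n: "n = 3" then have "s = 2" using assms by simp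
    then show ?thesis using n Fill_double[of 2 1] by (simp add: Fill_by_count)
  next
    assume n: "n = 4" then have "s = 4" using assms by simp
    then show ?thesis using n Fill_double[of 3 2] by (simp add: Fill_by_count)
  next
    assume n: "n = 5" then have "s = 6" using assms by simp
    then show ?thesis using n Fill_double[of 4 3] \<open>Fill 4 3 3\<close> by simp
  next
    assume n: "n = 6" then have "s = 10" using assms by simp
    then show ?thesis using n Fill_double[of 5 5] \<open>Fill 5 5 5\<close> by simp
  next
    assume n: "n = 7" then have "s = 16" using assms by simp
    then show ?thesis using n Fill_double[of 6 8] by (simp add: Fill_by_count)
  next
    assume n: "n = 8" then have "s = 29" using assms by simp
    then show ?thesis using n f8 by simp
  next
    assume n: "n = 9" then have "s = 52" using assms by simp
    then show ?thesis using n Fill_double[of 8 26] by (simp add: Fill_by_count)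
  next
    assume n: "n = 10" then have "s = 94" using assms by simp
    then show ?thesis using n Fill_double[of 9 47] by (simp add: Fill_by_count)
  qed
qed

section \<open>Constructible sets\<close>

text \<open>Here \<open>d\<close> is a formal degree: the coefficient at \<open>d\<close> may vanish
  for some or all \<open>c\<close>.\<close>

definition polyfam :: "nat \<Rightarrow> (('v \<Rightarrow> complex) \<Rightarrow> complex poly) \<Rightarrow> bool" where
  "polyfam d p \<longleftrightarrow> (\<forall>c. degree (p c) \<le> d) \<and> (\<forall>i. (\<lambda>c. coeff (p c) i) \<in> polyfun)"

lemma polyfam_degree: "polyfam d p \<Longrightarrow> degree (p c) \<le> d"
  and polyfam_coeff: "polyfam d p \<Longrightarrow> (\<lambda>c. coeff (p c) i) \<in> polyfun"
  by (simp_all add: polyfam_def)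

lemma polyfam_add:
  assumes "polyfam d p" "polyfam e q"
  shows "polyfam (max d e) (\<lambda>c. p c + q c)"
  using assms unfolding polyfam_def
  by (auto intro!: degree_add_le polyfun.add intro: le_max_iff_disj[THEN iffD2])

lemma polyfam_diff:
  assumes "polyfam d p" "polyfam d q"
  shows "polyfam d (\<lambda>c. p c - q c)"
  using assms unfolding polyfam_def by (auto intro!: degree_diff_le polyfun_diff)

lemma polyfam_mult:
  assumes "polyfam d p" "polyfam e q"
  shows "polyfam (d + e) (\<lambda>c. p c * q c)"
  unfolding polyfam_def coeff_mult
proof (intro conjI allI)
  fix c
  have "degree (p c * q c) \<le> degree (p c) + degree (q c)" by (rule degree_mult_le)
  also have "\<dots> \<le> d + e" using assms by (intro add_mono) (simp_all add: polyfam_degree)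
  finally show "degree (p c * q c) \<le> d + e" .
qed (use assms in \<open>auto intro!: polyfun_sum polyfun.mult simp: polyfam_coeff\<close>)

lemma polyfam_power: "polyfam d p \<Longrightarrow> polyfam (k * d) (\<lambda>c. p c ^ k)"
proof (induction k)
  case 0
  show ?case by (auto simp: polyfam_def intro: polyfun.const)
next
  case (Suc k)
  then show ?case using polyfam_mult[of d p "k * d"] by simp
qed

lemma polyfam_monom:
  assumes "P \<in> polyfun" "k \<le> d"
  shows "polyfam d (\<lambda>c. monom (P c) k)"
  unfolding polyfam_def
proof (intro conjI allI)
  show "degree (monom (P c) k) \<le> d" for c
    using degree_monom_le assms(2) by (rule le_trans)
  show "(\<lambda>c. coeff (monom (P c) k) i) \<in> polyfun" for i
    using assms(1) by (cases "k = i") (simp_all add: polyfun.const)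
qed

lemma polyfam_smult:
  assumes "P \<in> polyfun" "polyfam d p"
  shows "polyfam d (\<lambda>c. smult (P c) (p c))"
  using assms unfolding polyfam_def by (auto intro: polyfun.mult le_trans[OF degree_smult_le])

lemma polyfam_lower:
  assumes "polyfam d p" "\<And>c. coeff (p c) d = 0"
  shows "polyfam (d - 1) p"
  unfolding polyfam_def
proof (intro conjI allI)
  fix c
  show "degree (p c) \<le> d - 1"
  proof (rule degree_le, intro allI impI)
    fix i assume "d - 1 < i"
    then have "i = d \<or> degree (p c) < i" using polyfam_degree[OF assms(1), of c] by linarith
    then show "coeff (p c) i = 0" using assms(2) by (auto simp: coeff_eq_0)
  qed
qed (use assms(1) in \<open>simp add: polyfam_coeff\<close>)

lemma polyfun_as_polyfam:
  assumes "P \<in> polyfun"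
  shows "\<exists>d p. polyfam d p \<and> (\<forall>c z. P (c(x := z)) = poly (p c) z)"
  using assms
proof induction
  case (const k)
  show ?case
    by (rule exI[of _ 0], rule exI[of _ "\<lambda>c. monom k 0"])
      (simp add: polyfam_monom polyfun.const poly_monom)
next
  case (var v)
  show ?case
  proof (cases "v = x")
    case True
    show ?thesis
      by (rule exI[of _ 1], rule exI[of _ "\<lambda>c. monom 1 1"])
        (simp add: polyfam_monom polyfun.const poly_monom True)
  next
    case False
    then show ?thesis
      by (intro exI[of _ 0] exI[of _ "\<lambda>c. monom (c v) 0"])
        (simp add: polyfam_monom polyfun.var poly_monom)
  qed
next
  case (add P Q)
  then obtain d p e q where p: "polyfam d p" "\<forall>c z. P (c(x := z)) = poly (p c) z"
    and q: "polyfam e q" "\<forall>c z. Q (c(x := z)) = poly (q c) z" by (elim exE conjE)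
  have "\<forall>c z. P (c(x := z)) + Q (c(x := z)) = poly (p c + q c) z"
    by (simp only: p(2) q(2) poly_add simp_thms)
  with polyfam_add[OF p(1) q(1)] show ?case by (intro exI conjI)
next
  case (mult P Q)
  then obtain d p e q where p: "polyfam d p" "\<forall>c z. P (c(x := z)) = poly (p c) z"
    and q: "polyfam e q" "\<forall>c z. Q (c(x := z)) = poly (q c) z" by (elim exE conjE)
  have "\<forall>c z. P (c(x := z)) * Q (c(x := z)) = poly (p c * q c) z"
    by (simp only: p(2) q(2) poly_mult simp_thms)
  with polyfam_mult[OF p(1) q(1)] show ?case by (intro exI conjI)
qed

inductive constructible :: "('v \<Rightarrow> complex) set \<Rightarrow> bool" where
  basic: "finite F \<Longrightarrow> F \<subseteq> polyfun \<Longrightarrow> g \<in> polyfun \<Longrightarrow>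
    constructible {c. (\<forall>f\<in>F. f c = 0) \<and> g c \<noteq> 0}"
| Un: "constructible S \<Longrightarrow> constructible T \<Longrightarrow> constructible (S \<union> T)"

lemma constructible_eq: "P \<in> polyfun \<Longrightarrow> constructible {c. P c = 0}"
  using constructible.basic[of "{P}" "\<lambda>_. 1"] by (simp add: polyfun.const)

lemma constructible_neq: "P \<in> polyfun \<Longrightarrow> constructible {c. P c \<noteq> 0}"
  using constructible.basic[of "{}" P] by simp

lemma constructible_empty: "constructible {}"
  using constructible_neq[OF polyfun.const[of 0]] by simp

lemma constructible_Int:
  assumes "constructible S" "constructible T"
  shows "constructible (S \<inter> T)"
  using assms
proof (induction S)
  case (basic F g)
  show ?case using basic.prems
  proof (induction T)
    case (basic F' g')
    have "{c. (\<forall>f\<in>F. f c = 0) \<and> g c \<noteq> 0} \<inter> {c. (\<forall>f\<in>F'. f c = 0) \<and> g' c \<noteq> 0} =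
        {c. (\<forall>f\<in>F \<union> F'. f c = 0) \<and> g c * g' c \<noteq> 0}" by auto
    moreover have "constructible \<dots>"
      using basic.hyps \<open>finite F\<close> \<open>F \<subseteq> polyfun\<close> \<open>g \<in> polyfun\<close>
      by (intro constructible.basic polyfun.mult) auto
    ultimately show ?case by simp
  next
    case (Un S T)
    then show ?case by (simp add: Int_Un_distrib constructible.Un)
  qed
next
  case (Un S S')
  then show ?case by (simp add: Int_Un_distrib2 constructible.Un)
qed

lemma constructible_UN:
  "finite I \<Longrightarrow> (\<And>i. i \<in> I \<Longrightarrow> constructible (S i)) \<Longrightarrow> constructible (\<Union>i\<in>I. S i)"
  by (induction I rule: finite_induct) (simp_all add: constructible_empty constructible.Un)

lemma constructible_nonzero:
  assumes "polyfam d p"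
  shows "constructible {c. p c \<noteq> 0}"
proof -
  have "p c \<noteq> 0 \<longleftrightarrow> (\<exists>i\<le>d. coeff (p c) i \<noteq> 0)" for c
    using polyfam_degree[OF assms, of c] by (metis coeff_0 leading_coeff_neq_0)
  then have "{c. p c \<noteq> 0} = (\<Union>i\<in>{..d}. {c. coeff (p c) i \<noteq> 0})" by auto
  then show ?thesis
    using constructible_UN[of "{..d}" "\<lambda>i. {c. coeff (p c) i \<noteq> 0}"]
      constructible_neq[OF polyfam_coeff[OF assms]] by simp
qed

text \<open>Pseudo-division by \<open>p\<close>: where its leading coefficient is nonzero, scaling
  \<open>q\<close> by it does not affect divisibility, and the formal degree of \<open>q\<close>
  drops until divisibility means that \<open>q\<close> vanishes.\<close>

lemma constructible_not_dvd:
  assumes p: "polyfam d p"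
  shows "polyfam e q \<Longrightarrow> constructible {c. coeff (p c) d \<noteq> 0 \<and> \<not> p c dvd q c}"
proof (induction e arbitrary: q rule: less_induct)
  case (less e)
  have deg: "degree (p c) = d" if "coeff (p c) d \<noteq> 0" for c
    using polyfam_degree[OF p, of c] le_degree[OF that] by simp
  have nz: "constructible {c. coeff (p c) d \<noteq> 0}"
    by (rule constructible_neq) (rule polyfam_coeff[OF p])
  show ?case
  proof (cases "e < d")
    case True
    have "p c dvd q c \<longleftrightarrow> q c = 0" if "coeff (p c) d \<noteq> 0" for c
      using deg[OF that] polyfam_degree[OF less.prems, of c] True
      by (metis dvd_0_right dvd_imp_degree_le le_trans not_le)
    then have "{c. coeff (p c) d \<noteq> 0 \<and> \<not> p c dvd q c} = {c. coeff (p c) d \<noteq> 0} \<inter> {c. q c \<noteq> 0}" by auto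
    then show ?thesis using constructible_Int[OF nz constructible_nonzero[OF less.prems]] by simp
  next
    case False
    define q' where "q' c = smult (coeff (p c) d) (q c) - monom (coeff (q c) e) (e - d) * p c" for c
    have "polyfam (e - d + d) (\<lambda>c. monom (coeff (q c) e) (e - d) * p c)"
      by (intro polyfam_mult polyfam_monom polyfam_coeff[OF less.prems] p) simp
    then have q'e: "polyfam e q'"
      unfolding q'_def using False
      by (intro polyfam_diff polyfam_smult polyfam_coeff[OF p] less.prems) simp
    have top: "coeff (q' c) e = 0" for c
      using False by (simp add: q'_def coeff_monom_mult)
    have dvd: "p c dvd q' c \<longleftrightarrow> p c dvd q c" if "coeff (p c) d \<noteq> 0" for c
      using that by (simp add: q'_def dvd_diff_left_iff dvd_smult_iff)
    show ?thesis
    proof (cases "e = 0")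
      case True
      have "p c dvd q c" if "coeff (p c) d \<noteq> 0" for c
      proof -
        have "degree (q' c) = 0" using polyfam_degree[OF q'e, of c] True by simp
        then have "q' c = 0" using top[of c] True by (metis leading_coeff_0_iff)
        then show ?thesis using dvd[OF that] by simp
      qed
      then have "{c. coeff (p c) d \<noteq> 0 \<and> \<not> p c dvd q c} = {}" by auto
      then show ?thesis using constructible_empty by (simp only:)
    next
      case False
      have "{c. coeff (p c) d \<noteq> 0 \<and> \<not> p c dvd q c} = {c. coeff (p c) d \<noteq> 0 \<and> \<not> p c dvd q' c}"
        using dvd by auto
      then show ?thesis
        using less.IH[of "e - 1" q'] polyfam_lower[OF q'e top] False by simp
    qed
  qed
qed

text \<open>Meant for a polynomial whose top coefficient vanishes. With formal degree 0 it is then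
  the zero polynomial and imposes no condition, hence the empty list.\<close>

definition lower :: "nat \<times> (('v \<Rightarrow> complex) \<Rightarrow> complex poly) \<Rightarrow> (nat \<times> (('v \<Rightarrow> complex) \<Rightarrow> complex poly)) list" where
  "lower dp = (if fst dp = 0 then [] else [(fst dp - 1, snd dp)])"

lemma lower_ok:
  assumes "polyfam d p" "\<And>c. coeff (p c) d = 0"
  shows "\<forall>ep\<in>set (lower (d, p)). polyfam (fst ep) (snd ep)"
    and "(\<forall>ep\<in>set (lower (d, p)). poly (snd ep c) z = 0) \<longleftrightarrow> poly (p c) z = 0"
    and "(\<Sum>ep\<leftarrow>lower (d, p). fst ep + 1) = d"
proof -
  show "\<forall>ep\<in>set (lower (d, p)). polyfam (fst ep) (snd ep)"
    using polyfam_lower[OF assms] by (simp add: lower_def)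
  have "p c = 0" if "d = 0"
    using assms(2)[of c] polyfam_degree[OF assms(1), of c] that by (metis le_zero_eq leading_coeff_0_iff)
  then show "(\<forall>ep\<in>set (lower (d, p)). poly (snd ep c) z = 0) \<longleftrightarrow> poly (p c) z = 0"
    by (simp add: lower_def)
qed (simp add: lower_def)

text \<open>The Euclidean algorithm, with a case distinction whether the leading coefficients vanish.\<close>

lemma constructible_common_root:
  fixes q :: "('v \<Rightarrow> complex) \<Rightarrow> complex poly"
  assumes "\<forall>dp\<in>set L. polyfam (fst dp) (snd dp)" "polyfam e q"
  shows "constructible {c. \<exists>z. (\<forall>dp\<in>set L. poly (snd dp c) z = 0) \<and> poly (q c) z \<noteq> 0}"
  using assms(1)
proof (induction "\<Sum>dp\<leftarrow>L. fst dp + 1" arbitrary: L rule: less_induct)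
  case less
  define S where "S L = {c. \<exists>z. (\<forall>dp\<in>set L. poly (snd dp c) z = 0) \<and> poly (q c) z \<noteq> 0}"
    for L :: "(nat \<times> (('v \<Rightarrow> complex) \<Rightarrow> complex poly)) list"
  \<comment> \<open>On this locus removing the top term changes no value, but it lowers the formal
    degree and with it the induction measure.\<close>
  have drop_top: "constructible (S ((d, p) # L') \<inter> {c. coeff (p c) d = 0})"
    if p: "polyfam d p" and L': "\<forall>dp\<in>set L'. polyfam (fst dp) (snd dp)"
      and m: "(\<Sum>dp\<leftarrow>L. fst dp + 1) = d + 1 + (\<Sum>dp\<leftarrow>L'. fst dp + 1)" for d p L'
  proof -
    define p' where "p' c = p c - monom (coeff (p c) d) d" for c
    have p': "polyfam d p'" "\<And>c. coeff (p' c) d = 0"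
      unfolding p'_def by (intro polyfam_diff p polyfam_monom polyfam_coeff[OF p] le_refl) simp
    have p'_eq: "p' c = p c" if "coeff (p c) d = 0" for c using that by (simp add: p'_def)
    have "S ((d, p) # L') \<inter> {c. coeff (p c) d = 0} = S (lower (d, p') @ L') \<inter> {c. coeff (p c) d = 0}"
      unfolding S_def set_append ball_Un using lower_ok(2)[OF p'] by (auto simp: p'_eq)
    moreover have c: "constructible (S (lower (d, p') @ L'))"
      unfolding S_def using lower_ok(1,3)[OF p'] L' m by (intro less.hyps) auto
    ultimately show ?thesis
      by (simp only:) (intro constructible_Int c constructible_eq polyfam_coeff[OF p])
  qed
  have split: "constructible T" if "constructible (T \<inter> {c. P c = 0})" "constructible (T \<inter> {c. P c \<noteq> 0})"
    for T and P :: "('v \<Rightarrow> complex) \<Rightarrow> complex"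
  proof -
    have "T = (T \<inter> {c. P c = 0}) \<union> (T \<inter> {c. P c \<noteq> 0})" by blast
    then show ?thesis using constructible.Un[OF that] by simp
  qed
  have two: "constructible (S ((d1, p1) # (d2, p2) # L'))"
    if p: "polyfam d1 p1" "polyfam d2 p2" and L': "\<forall>dp\<in>set L'. polyfam (fst dp) (snd dp)" and "d2 \<le> d1"
      and m: "(\<Sum>dp\<leftarrow>L. fst dp + 1) = d1 + 1 + (d2 + 1) + (\<Sum>dp\<leftarrow>L'. fst dp + 1)" for d1 p1 d2 p2 L'
  proof (rule split[where P = "\<lambda>c. coeff (p2 c) d2"])
    have "S ((d1, p1) # (d2, p2) # L') = S ((d2, p2) # (d1, p1) # L')" unfolding S_def by auto
    then show "constructible (S ((d1, p1) # (d2, p2) # L') \<inter> {c. coeff (p2 c) d2 = 0})"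
      using drop_top[of d2 p2 "(d1, p1) # L'"] p L' m by simp
    \<comment> \<open>At a root of \<open>p2\<close> this is \<open>p1\<close> times the leading
      coefficient of \<open>p2\<close>, which is nonzero on the locus considered, so the common
      roots are unchanged.\<close>
    define p' where "p' c = smult (coeff (p2 c) d2) (p1 c) - monom (coeff (p1 c) d1) (d1 - d2) * p2 c" for c
    have "polyfam (d1 - d2 + d2) (\<lambda>c. monom (coeff (p1 c) d1) (d1 - d2) * p2 c)"
      by (intro polyfam_mult polyfam_monom polyfam_coeff[OF p(1)] p) simp
    then have p'd: "polyfam d1 p'"
      unfolding p'_def using \<open>d2 \<le> d1\<close>
      by (intro polyfam_diff polyfam_smult polyfam_coeff[OF p(2)] p) simp
    have top: "coeff (p' c) d1 = 0" for c
      using \<open>d2 \<le> d1\<close> by (simp add: p'_def coeff_monom_mult)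
    have "poly (p' c) z = coeff (p2 c) d2 * poly (p1 c) z" if "poly (p2 c) z = 0" for c z
      using that by (simp add: p'_def)
    then have "c \<in> S ((d1, p1) # (d2, p2) # L') \<longleftrightarrow> c \<in> S (lower (d1, p') @ (d2, p2) # L')"
      if "coeff (p2 c) d2 \<noteq> 0" for c
      unfolding S_def mem_Collect_eq set_append ball_Un
      by (intro ex_cong1) (use that lower_ok(2)[OF p'd top] in auto)
    then have "S ((d1, p1) # (d2, p2) # L') \<inter> {c. coeff (p2 c) d2 \<noteq> 0} =
        S (lower (d1, p') @ (d2, p2) # L') \<inter> {c. coeff (p2 c) d2 \<noteq> 0}"
      by auto
    moreover have c: "constructible (S (lower (d1, p') @ (d2, p2) # L'))"
      unfolding S_def using lower_ok(1,3)[OF p'd top] p L' m by (intro less.hyps) auto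
    ultimately show "constructible (S ((d1, p1) # (d2, p2) # L') \<inter> {c. coeff (p2 c) d2 \<noteq> 0})"
      by (simp only:) (intro constructible_Int c constructible_neq polyfam_coeff[OF p(2)])
  qed
  show ?case unfolding S_def[symmetric]
  proof (cases L)
    case Nil
    have "(\<exists>z. poly (q c) z \<noteq> 0) \<longleftrightarrow> q c \<noteq> 0" for c using poly_all_0_iff_0 by blast
    then show "constructible (S L)" unfolding S_def Nil using constructible_nonzero[OF assms(2)] by simp
  next
    case (Cons dp L')
    obtain d p where dp: "dp = (d, p)" by (cases dp)
    have p: "polyfam d p" and L': "\<forall>dp\<in>set L'. polyfam (fst dp) (snd dp)"
      using less.prems by (simp_all add: Cons dp)
    show "constructible (S L)"
    proof (cases L')
      case Nil
      show ?thesis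
      proof (rule split[where P = "\<lambda>c. coeff (p c) d"])
        show "constructible (S L \<inter> {c. coeff (p c) d = 0})"
          using drop_top[OF p, of "[]"] by (simp add: Cons dp Nil)
        \<comment> \<open>By the Nullstellensatz in one variable, the roots of \<open>p c\<close>
          are all roots of \<open>q c\<close> exactly if \<open>p c\<close> divides a power of
          \<open>q c\<close>; the degree of \<open>p c\<close> is a sufficient exponent.\<close>
        have "(\<exists>z. poly (p c) z = 0 \<and> poly (q c) z \<noteq> 0) \<longleftrightarrow> \<not> p c dvd q c ^ d"
          if "coeff (p c) d \<noteq> 0" for c
        proof -
          have "degree (p c) = d" "p c \<noteq> 0"
            using polyfam_degree[OF p, of c] le_degree[OF that] that by auto
          then show ?thesis using nullstellensatz_univariate[of "p c" "q c"] by auto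
        qed
        then have "S L \<inter> {c. coeff (p c) d \<noteq> 0} = {c. coeff (p c) d \<noteq> 0 \<and> \<not> p c dvd q c ^ d}"
          unfolding S_def by (auto simp: Cons dp Nil)
        then show "constructible (S L \<inter> {c. coeff (p c) d \<noteq> 0})"
          using constructible_not_dvd[OF p polyfam_power[OF assms(2)]] by simp
      qed
    next
      case (Cons dp' L'')
      obtain d' p' where dp': "dp' = (d', p')" by (cases dp')
      have p': "polyfam d' p'" and L'': "\<forall>dp\<in>set L''. polyfam (fst dp) (snd dp)"
        using L' by (simp_all add: Cons dp')
      have L: "L = (d, p) # (d', p') # L''" using \<open>L = dp # L'\<close> by (simp add: Cons dp dp')
      show ?thesis
      proof (cases "d' \<le> d")
        case True
        then show ?thesis using two[OF p p' L''] by (simp add: L)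
      next
        case False
        moreover have "S L = S ((d', p') # (d, p) # L'')" unfolding S_def L by auto
        ultimately show ?thesis using two[OF p' p L''] by (simp add: L)
      qed
    qed
  qed
qed

text \<open>Chevalley's theorem for forgetting one coordinate; the image is kept as a cylinder over
  the same set of variables.\<close>

lemma constructible_project:
  assumes "constructible S"
  shows "constructible {c. \<exists>z. c(x := z) \<in> S}"
  using assms
proof induction
  case (basic F g)
  have "\<forall>f\<in>F. \<exists>dp. polyfam (fst dp) (snd dp) \<and> (\<forall>c z. f (c(x := z)) = poly (snd dp c) z)"
    using basic.hyps(2) polyfun_as_polyfam[where x = x] by fastforce
  then obtain r where r: "\<forall>f\<in>F. polyfam (fst (r f)) (snd (r f)) \<and> (\<forall>c z. f (c(x := z)) = poly (snd (r f) c) z)"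
    by (rule bchoice[THEN exE])
  obtain e q where q: "polyfam e q" "\<forall>c z. g (c(x := z)) = poly (q c) z"
    using polyfun_as_polyfam[OF basic.hyps(3), of x] by (elim exE conjE)
  obtain xs where xs: "set xs = F" using finite_list[OF basic.hyps(1)] ..
  have "{c. \<exists>z. c(x := z) \<in> {c. (\<forall>f\<in>F. f c = 0) \<and> g c \<noteq> 0}} =
      {c. \<exists>z. (\<forall>dp\<in>set (map r xs). poly (snd dp c) z = 0) \<and> poly (q c) z \<noteq> 0}"
    using r q(2) by (simp add: xs)
  moreover have "constructible \<dots>"
    by (rule constructible_common_root[OF _ q(1)]) (use r in \<open>simp add: xs\<close>)
  ultimately show ?case by (simp only:)
next
  case (Un S T)
  have "{c. \<exists>z. c(x := z) \<in> S \<union> T} = {c. \<exists>z. c(x := z) \<in> S} \<union> {c. \<exists>z. c(x := z) \<in> T}" by auto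
  then show ?case using constructible.Un[OF Un.IH] by (simp only:)
qed

lemma constructible_project_finite:
  assumes "finite X" "constructible S"
  shows "constructible {c. \<exists>w. (\<lambda>v. if v \<in> X then w v else c v) \<in> S}"
  using assms(1)
proof (induction X rule: finite_induct)
  case empty
  then show ?case using assms(2) by simp
next
  case (insert x X)
  have "(\<exists>w. (\<lambda>v. if v \<in> insert x X then w v else c v) \<in> S) \<longleftrightarrow>
      (\<exists>z w. (\<lambda>v. if v \<in> X then w v else (c(x := z)) v) \<in> S)" for c
  proof
    assume "\<exists>w. (\<lambda>v. if v \<in> insert x X then w v else c v) \<in> S"
    then obtain w where "(\<lambda>v. if v \<in> insert x X then w v else c v) \<in> S" ..
    moreover have "(\<lambda>v. if v \<in> insert x X then w v else c v) = (\<lambda>v. if v \<in> X then w v else (c(x := w x)) v)"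
      by auto
    ultimately have "(\<lambda>v. if v \<in> X then w v else (c(x := w x)) v) \<in> S" by simp
    then show "\<exists>z w. (\<lambda>v. if v \<in> X then w v else (c(x := z)) v) \<in> S" by (intro exI)
  next
    assume "\<exists>z w. (\<lambda>v. if v \<in> X then w v else (c(x := z)) v) \<in> S"
    then obtain z w where "(\<lambda>v. if v \<in> X then w v else (c(x := z)) v) \<in> S" by (elim exE)
    moreover have "(\<lambda>v. if v \<in> X then w v else (c(x := z)) v) = (\<lambda>v. if v \<in> insert x X then (w(x := z)) v else c v)"
      using insert.hyps by auto
    ultimately have "(\<lambda>v. if v \<in> insert x X then (w(x := z)) v else c v) \<in> S" by simp
    then show "\<exists>w. (\<lambda>v. if v \<in> insert x X then w v else c v) \<in> S" by (rule exI[of _ "w(x := z)"])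
  qed
  then show ?case using constructible_project[OF insert.IH, of x] by simp
qed

text \<open>Irreducibility handles the union: if both parts lie in proper zero sets, so does their
  union, since the product of the two polynomials is nonzero.\<close>

lemma constructible_thin_or_thick:
  assumes "constructible S"
  shows "(\<exists>h\<in>polyfun. (\<exists>c. h c \<noteq> 0) \<and> (\<forall>c\<in>S. h c = 0)) \<or>
    (\<exists>g\<in>polyfun. (\<exists>c. g c \<noteq> 0) \<and> (\<forall>c. g c \<noteq> 0 \<longrightarrow> c \<in> S))"
  using assms
proof induction
  case (basic F g)
  consider "\<forall>c. g c = 0" | f c where "f \<in> F" "f c \<noteq> 0" | "\<forall>f\<in>F. \<forall>c. f c = 0" "\<exists>c. g c \<noteq> 0" by blast
  then show ?case
  proof cases
    case 1
    then show ?thesis by (intro disjI1 bexI[of _ "\<lambda>_. 1"]) (simp_all add: polyfun.const)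
  next
    case (2 f c)
    then show ?thesis using basic.hyps(2) by (intro disjI1 bexI[of _ f]) auto
  next
    case 3
    then show ?thesis using basic.hyps(3) by (intro disjI2 bexI[of _ g]) auto
  qed
next
  case (Un S T)
  let ?thin = "\<lambda>S. \<exists>h\<in>polyfun. (\<exists>c. h c \<noteq> 0) \<and> (\<forall>c\<in>S. h c = 0)"
  let ?thick = "\<lambda>S. \<exists>g\<in>polyfun. (\<exists>c. g c \<noteq> 0) \<and> (\<forall>c. g c \<noteq> 0 \<longrightarrow> c \<in> S)"
  have mono: "?thick T \<Longrightarrow> T \<subseteq> T' \<Longrightarrow> ?thick T'" for T T'
    by (erule bexE, rule bexI) auto
  show ?case
  proof (cases "?thick S \<or> ?thick T")
    case True
    then have "?thick (S \<union> T)"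
    proof
      assume "?thick S"
      then show ?thesis by (rule mono) simp
    next
      assume "?thick T"
      then show ?thesis by (rule mono) simp
    qed
    then show ?thesis by (rule disjI2)
  next
    case False
    with Un.IH have "?thin S" "?thin T" by argo+
    then obtain h h' where h: "h \<in> polyfun" "\<exists>c. h c \<noteq> 0" "\<forall>c\<in>S. h c = 0"
      "h' \<in> polyfun" "\<exists>c. h' c \<noteq> 0" "\<forall>c\<in>T. h' c = 0" by (elim bexE conjE)
    from h(2,5) obtain a b where "h a \<noteq> 0" "h' b \<noteq> 0" by (elim exE)
    then have "\<exists>c. h c \<noteq> 0 \<and> h' c \<noteq> 0" by (rule polyfun_common_nonzero[OF h(1,4)])
    then have "\<exists>c. h c * h' c \<noteq> 0" by simp
    then show ?thesis
      using polyfun.mult[OF h(1,4)] h(3,6) by (intro disjI1 bexI[of _ "\<lambda>c. h c * h' c"]) auto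
  qed
qed

section \<open>Terracini's lemma\<close>

definition sum_map :: "nat \<Rightarrow> nat \<Rightarrow> (nat \<Rightarrow> nat \<Rightarrow> 2 \<Rightarrow> complex) \<Rightarrow> tensor" where
  "sum_map n s X i = (if length i = n then \<Sum>j<s. tp n (X j) i else 0)"

lemma polynomial_functions_sum:
  "(\<And>i. i \<in> I \<Longrightarrow> p i \<in> polynomial_functions n) \<Longrightarrow> (\<lambda>T. \<Sum>i\<in>I. p i T) \<in> polynomial_functions n"
  by (induction I rule: infinite_finite_induct) (auto intro: polynomial_functions.intros)

lemma polynomial_functions_cong:
  assumes "p \<in> polynomial_functions n" "\<And>i. length i = n \<Longrightarrow> S i = T i"
  shows "p S = p T"
  using assms(1) by induction (simp_all add: assms(2))

lemma polynomial_functions_translate: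
  assumes "p \<in> polynomial_functions n"
  shows "(\<lambda>T. p (\<lambda>i. T0 i + T i)) \<in> polynomial_functions n"
  using assms by induction (auto intro: polynomial_functions.intros)

lemma polynomial_functions_tendsto:
  assumes "p \<in> polynomial_functions n" "\<And>i. length i = n \<Longrightarrow> ((\<lambda>z. Y z i) \<longlongrightarrow> y i) F"
  shows "((\<lambda>z. p (Y z)) \<longlongrightarrow> p y) F"
  using assms(1) by induction (auto intro!: tendsto_intros assms(2))

text \<open>The coefficients of \<open>Q T\<close> are the homogeneous components of
  \<open>p\<close>, evaluated at \<open>T\<close>.\<close>

lemma polynomial_functions_ray:
  assumes "p \<in> polynomial_functions n"
  shows "\<exists>Q D. (\<forall>T z. p (\<lambda>i. z * T i) = poly (Q T) z) \<and> (\<forall>T. degree (Q T) \<le> D) \<and>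
    (\<forall>k. (\<lambda>T. coeff (Q T) k) \<in> polynomial_functions n)"
  using assms
proof induction
  case (const c)
  show ?case
    by (rule exI[of _ "\<lambda>T. [:c:]"], rule exI[of _ 0]) (simp add: polynomial_functions.const)
next
  case (coord i)
  have "coeff [:0, T i:] k = (if k = 1 then T i else 0)" for T :: tensor and k
    by (auto simp: coeff_pCons split: nat.split)
  then have "(\<lambda>T. coeff [:0, T i:] k) \<in> polynomial_functions n" for k
    using polynomial_functions.coord[OF coord] polynomial_functions.const[of 0 n]
    by (cases "k = 1") simp_all
  then show ?case
    by (intro exI[of _ "\<lambda>T. [:0, T i:]"] exI[of _ 1]) simp
next
  case (add p q)
  then obtain P D Q E where P: "\<forall>T z. p (\<lambda>i. z * T i) = poly (P T) z" "\<forall>T. degree (P T) \<le> D"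
      "\<forall>k. (\<lambda>T. coeff (P T) k) \<in> polynomial_functions n"
    and Q: "\<forall>T z. q (\<lambda>i. z * T i) = poly (Q T) z" "\<forall>T. degree (Q T) \<le> E"
      "\<forall>k. (\<lambda>T. coeff (Q T) k) \<in> polynomial_functions n" by (elim exE conjE)
  have "degree (P T + Q T) \<le> max D E" for T
    using P(2) Q(2) by (intro degree_add_le) (simp_all add: le_max_iff_disj)
  moreover have "(\<lambda>T. coeff (P T + Q T) k) \<in> polynomial_functions n" for k
    unfolding coeff_add using P(3) Q(3) by (intro polynomial_functions.add) simp_all
  ultimately show ?case using P(1) Q(1)
    by (intro exI[of _ "\<lambda>T. P T + Q T"] exI[of _ "max D E"]) simp
next
  case (mult p q)
  then obtain P D Q E where P: "\<forall>T z. p (\<lambda>i. z * T i) = poly (P T) z" "\<forall>T. degree (P T) \<le> D"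
      "\<forall>k. (\<lambda>T. coeff (P T) k) \<in> polynomial_functions n"
    and Q: "\<forall>T z. q (\<lambda>i. z * T i) = poly (Q T) z" "\<forall>T. degree (Q T) \<le> E"
      "\<forall>k. (\<lambda>T. coeff (Q T) k) \<in> polynomial_functions n" by (elim exE conjE)
  have "degree (P T * Q T) \<le> D + E" for T
    using degree_mult_le[of "P T" "Q T"] P(2) Q(2) by (meson add_mono le_trans)
  moreover have "(\<lambda>T. coeff (P T * Q T) k) \<in> polynomial_functions n" for k
    unfolding coeff_mult using P(3) Q(3)
    by (intro polynomial_functions_sum polynomial_functions.mult) simp_all
  ultimately show ?case using P(1) Q(1)
    by (intro exI[of _ "\<lambda>T. P T * Q T"] exI[of _ "D + E"]) simp
qed

lemma tp_update:
  assumes "k < n"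
  shows "tp n (x(k := u)) i = u (i ! k) * (\<Prod>l\<in>{..<n} - {k}. x l (i ! l))"
proof -
  have "tp n (x(k := u)) i = u (i ! k) * (\<Prod>l\<in>{..<n} - {k}. (x(k := u)) l (i ! l))"
    unfolding tp_def using assms by (subst prod.remove[of _ k]) auto
  also have "(\<Prod>l\<in>{..<n} - {k}. (x(k := u)) l (i ! l)) = (\<Prod>l\<in>{..<n} - {k}. x l (i ! l))"
    by (intro prod.cong) auto
  finally show ?thesis .
qed

lemma sum_map_derivative:
  assumes "length i = n"
  shows "((\<lambda>z. sum_map n s (\<lambda>j k b. X j k b + z * U j k b) i) has_field_derivative
    (\<Sum>j<s. \<Sum>k<n. tp n ((X j)(k := U j k)) i)) (at 0)"
proof -
  have "((\<lambda>z. \<Prod>k<n. X j k (i ! k) + z * U j k (i ! k)) has_field_derivative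
      (\<Sum>k<n. U j k (i ! k) * (\<Prod>l\<in>{..<n} - {k}. X j l (i ! l) + 0 * U j l (i ! l)))) (at 0)" for j
    by (rule has_field_derivative_prod) (auto intro!: derivative_eq_intros)
  then have "((\<lambda>z. \<Prod>k<n. X j k (i ! k) + z * U j k (i ! k)) has_field_derivative
      (\<Sum>k<n. tp n ((X j)(k := U j k)) i)) (at 0)" for j
    by (simp add: tp_update)
  then show ?thesis
    unfolding sum_map_def tp_def[of n "\<lambda>k b. X _ k b + _ * U _ k b"] using assms
    by (simp add: DERIV_sum)
qed

text \<open>The left hand side ranges over the sum of the tangent spaces, the image of the derivative of
  \<^const>\<open>sum_map\<close> at \<open>X\<close>.\<close>

lemma tangent_space_spans:
  fixes s :: nat
  assumes "1 \<le> n" "fills n {..<s} {} X"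
  shows "\<exists>U. \<forall>i\<in>idx n. (\<Sum>j<s. \<Sum>k<n. tp n ((X j)(k := U j k)) i) = T i"
proof -
  define y where "y U i = (\<Sum>j<s. \<Sum>k<n. tp n ((X j)(k := U j k)) i)" for U i
  have "\<exists>v\<in>range y. \<forall>\<alpha>\<in>idx n. v \<alpha> = T \<alpha>"
  proof (rule separating_subspace)
    show "separating (idx n) (range y)"
      unfolding separating_def
    proof (intro allI impI ballI)
      fix \<phi> \<alpha> assume *: "\<forall>v\<in>range y. (\<Sum>\<alpha>\<in>idx n. \<phi> \<alpha> * v \<alpha>) = 0" and "\<alpha> \<in> idx n"
      have slot: "ev n \<phi> ((X j)(k := u)) = 0" if "j < s" "k < n" for j k u
      proof -
        \<comment> \<open>The tangent vector that moves only factor \<open>k\<close> of point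
          \<open>j\<close>.\<close>
        define U where "U j' k' = (if j' = j \<and> k' = k then u else (\<lambda>_. 0))" for j' k'
        have "(\<Sum>k'<n. tp n ((X j')(k' := U j' k')) \<beta>) = (if j' = j then tp n ((X j)(k := u)) \<beta> else 0)" for j' \<beta>
        proof -
          have "tp n ((X j')(k' := U j' k')) \<beta> = (if k' = k then if j' = j then tp n ((X j)(k := u)) \<beta> else 0 else 0)"
            if "k' < n" for k'
            using that by (auto simp: tp_update U_def)
          then have "(\<Sum>k'<n. tp n ((X j')(k' := U j' k')) \<beta>) =
              (\<Sum>k'<n. if k' = k then if j' = j then tp n ((X j)(k := u)) \<beta> else 0 else 0)"
            by (intro sum.cong) auto
          then show ?thesis using \<open>k < n\<close> by simp
        qed
        then have "y U \<beta> = (\<Sum>j'<s. if j' = j then tp n ((X j)(k := u)) \<beta> else 0)" for \<beta>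
          unfolding y_def by (intro sum.cong) simp_all
        then have yU: "y U = tp n ((X j)(k := u))"
          using \<open>j < s\<close> sum.delta[of "{..<s}" j] by (intro ext) simp
        show ?thesis using bspec[OF *, OF rangeI, of U] by (simp add: ev_def yU)
      qed
      show "\<phi> \<alpha> = 0"
        using assms(2)
      proof (rule fillsD)
        fix j assume j: "j \<in> {..<s}"
        \<comment> \<open>The value at the point is its derivative along its own vector in factor 0,
          which exists because \<open>1 \<le> n\<close>.\<close>
        have "ev n \<phi> (X j) = 0" using slot[of j 0 "X j 0"] j assms(1) by simp
        then show "sing n \<phi> (X j)"
          using slot j by (auto simp: sing_def dirs_def bump_def)
      qed (use \<open>\<alpha> \<in> idx n\<close> in auto)
    qed
    have "(\<lambda>_. 0) = y (\<lambda>_ _ _. 0)" by (simp add: y_def fun_eq_iff tp_update)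
    then show "(\<lambda>\<alpha>. 0) \<in> range y" by (rule range_eqI[of _ y])
  next
    fix u v k assume "u \<in> range y" "v \<in> range y"
    then obtain U V where "u = y U" "v = y V" by auto
    moreover have "(\<lambda>\<alpha>. y U \<alpha> + k * y V \<alpha>) = y (\<lambda>j l b. U j l b + k * V j l b)"
      unfolding y_def sum_distrib_left sum.distrib[symmetric]
      by (intro ext sum.cong refl) (simp add: tp_update algebra_simps)
    ultimately have "(\<lambda>\<alpha>. u \<alpha> + k * v \<alpha>) = y (\<lambda>j l b. U j l b + k * V j l b)" by simp
    then show "(\<lambda>\<alpha>. u \<alpha> + k * v \<alpha>) \<in> range y" by (rule range_eqI[of _ y])
  qed simp
  then show ?thesis by (auto simp: y_def)
qed

text \<open>If \<open>p\<close> does not vanish identically, its lowest homogeneous part at \<open>sum_map n s X\<close> does not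
  vanish at some tangent vector, hence \<open>p\<close> does not vanish along a curve of sums.\<close>

lemma sums_dense:
  fixes s :: nat
  assumes "1 \<le> n" "fills n {..<s} {} X" and p: "p \<in> polynomial_functions n"
    and zero: "\<And>X. p (sum_map n s X) = 0"
  shows "p T = 0"
proof (rule ccontr)
  assume "p T \<noteq> 0"
  define T0 where "T0 = sum_map n s X"
  define F where "F T = p (\<lambda>i. T0 i + T i)" for T
  have "F \<in> polynomial_functions n"
    unfolding F_def by (rule polynomial_functions_translate[OF p])
  from polynomial_functions_ray[OF this] obtain Q D
    where Q: "\<forall>T z. F (\<lambda>i. z * T i) = poly (Q T) z" "\<forall>T. degree (Q T) \<le> D"
      "\<forall>k. (\<lambda>T. coeff (Q T) k) \<in> polynomial_functions n" by (elim exE conjE)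
  have "poly (Q (\<lambda>i. T i - T0 i)) 1 \<noteq> 0"
    using Q(1)[rule_format, of 1 "\<lambda>i. T i - T0 i", symmetric] \<open>p T \<noteq> 0\<close> by (simp add: F_def)
  then have "\<exists>k S. coeff (Q S) k \<noteq> 0" by (metis leading_coeff_0_iff poly_0)
  \<comment> \<open>The order of vanishing of \<open>F\<close> at the origin; \<open>S\<close> is a
    direction in which its lowest homogeneous part does not vanish.\<close>
  define d where "d = (LEAST k. \<exists>S. coeff (Q S) k \<noteq> 0)"
  obtain S where S: "coeff (Q S) d \<noteq> 0"
    using LeastI_ex[OF \<open>\<exists>k S. coeff (Q S) k \<noteq> 0\<close>] unfolding d_def by auto
  have low: "coeff (Q S) k = 0" if "k < d" for k S
    using not_less_Least[OF that[unfolded d_def]] by blast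
  define G where "G S z = (\<Sum>k\<le>D. coeff (Q S) (k + d) * z ^ k)" for S z
  have G: "poly (Q S) z = z ^ d * G S z" for S z
  proof -
    have "poly (Q S) z = (\<Sum>k\<le>D + d. coeff (Q S) k * z ^ k)"
      unfolding poly_altdef using Q(2)[rule_format, of S]
      by (intro sum.mono_neutral_left) (auto simp: coeff_eq_0)
    also have "\<dots> = (\<Sum>k=0+d..D + d. coeff (Q S) k * z ^ k)"
      by (intro sum.mono_neutral_right) (auto simp: low)
    also have "\<dots> = (\<Sum>k=0..D. coeff (Q S) (k + d) * z ^ (k + d))"
      by (rule sum.shift_bounds_cl_nat_ivl)
    finally show ?thesis by (simp add: G_def sum_distrib_left power_add atMost_atLeast0 mult_ac)
  qed
  obtain U where U: "\<forall>i\<in>idx n. (\<Sum>j<s. \<Sum>k<n. tp n ((X j)(k := U j k)) i) = S i"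
    using tangent_space_spans[OF assms(1,2), of S] by blast
  \<comment> \<open>The difference quotient along a curve of sums whose tangent vector is
    \<open>S\<close>. Since \<open>F\<close> vanishes at z * Y z, dividing by \<open>z ^ d\<close>
    and letting z tend to 0 forces the lowest part to vanish at \<open>S\<close>.\<close>
  define Y where "Y z i = (sum_map n s (\<lambda>j k b. X j k b + z * U j k b) i - T0 i) / z" for z i
  have "((\<lambda>z. Y z i) \<longlongrightarrow> S i) (at 0)" if "length i = n" for i
    using DERIV_D[OF sum_map_derivative[OF that, of s X U]] U that
    by (simp add: Y_def T0_def idx_def)
  then have "((\<lambda>z. coeff (Q (Y z)) k) \<longlongrightarrow> coeff (Q S) k) (at 0)" for k
    using polynomial_functions_tendsto[OF Q(3)[rule_format]] by blast
  then have "((\<lambda>z. G (Y z) z) \<longlongrightarrow> (\<Sum>k\<le>D. coeff (Q S) (k + d) * 0 ^ k)) (at 0)"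
    unfolding G_def by (intro tendsto_intros)
  moreover have "(\<Sum>k\<le>D. coeff (Q S) (k + d) * 0 ^ k) = coeff (Q S) d"
    by (simp add: power_0_left if_distrib cong: if_cong)
  moreover have "G (Y z) z = 0" if "z \<noteq> 0" for z
  proof -
    have "F (\<lambda>i. z * Y z i) = p (sum_map n s (\<lambda>j k b. X j k b + z * U j k b))"
      using that by (simp add: F_def Y_def)
    then have "poly (Q (Y z)) z = 0" using Q(1) zero by simp
    then show ?thesis using G that by simp
  qed
  then have "((\<lambda>z. G (Y z) z) \<longlongrightarrow> 0) (at 0)"
    by (intro tendsto_eventually) (auto simp: eventually_at_filter)
  ultimately have "coeff (Q S) d = 0" by (metis LIM_unique)
  with S show False by simp
qed

section \<open>The dimension count\<close>

lemma separating_remove_zero: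
  assumes "separating A V" "V \<subseteq> insert (\<lambda>_. 0) W"
  shows "separating A W"
  unfolding separating_def
proof (intro allI impI ballI)
  fix \<phi> \<alpha> assume W: "\<forall>v\<in>W. (\<Sum>\<alpha>\<in>A. \<phi> \<alpha> * v \<alpha>) = 0" and "\<alpha> \<in> A"
  show "\<phi> \<alpha> = 0"
  proof (rule separatingD[OF assms(1)])
    fix v assume "v \<in> V"
    then have "v = (\<lambda>_. 0) \<or> v \<in> W" using assms(2) by auto
    then show "(\<Sum>\<alpha>\<in>A. \<phi> \<alpha> * v \<alpha>) = 0" using W by (elim disjE) simp_all
  qed (fact \<open>\<alpha> \<in> A\<close>)
qed

lemma separating_card:
  assumes "finite A" "finite V" "separating A V"
  shows "card A \<le> card V"
  using assms
proof (induction A arbitrary: V rule: finite_induct)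
  case empty
  show ?case by simp
next
  case (insert \<alpha> A)
  obtain v where v: "v \<in> V" "v \<alpha> \<noteq> 0"
    using separating_pivot[OF insert.prems(2) insert.hyps] by auto
  define f where "f w = (\<lambda>\<beta>. v \<alpha> * w \<beta> - w \<alpha> * v \<beta>)" for w
  have "separating A (f ` V)"
    unfolding f_def by (rule separating_eliminate[OF insert.prems(2) insert.hyps v])
  moreover have "f v = (\<lambda>_. 0)" by (simp add: f_def fun_eq_iff mult.commute)
  then have "f ` V \<subseteq> insert (\<lambda>_. 0) (f ` (V - {v}))" by auto
  ultimately have "separating A (f ` (V - {v}))" by (rule separating_remove_zero)
  then have "card A \<le> card (f ` (V - {v}))" using insert.IH insert.prems(1) by simp
  also have "\<dots> \<le> card (V - {v})" by (rule card_image_le) (use insert.prems(1) in simp)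
  also have "card (V - {v}) = card V - 1" using v(1) insert.prems(1) by simp
  finally show ?case using insert.hyps v(1) insert.prems(1) card_gt_0_iff[of V] by auto
qed

lemma digit_sum: "(\<Sum>i<N. (k div b ^ i mod b) * b ^ i) = k mod (b ^ N :: nat)"
proof (induction N)
  case (Suc N)
  have "k mod b ^ Suc N = b ^ N * (k div b ^ N mod b) + k mod b ^ N"
    using mod_mult2_eq[of k "b ^ N" b] by (simp add: mult.commute)
  then show ?case using Suc by simp
qed simp

text \<open>The exponent of \<open>X j k 2\<close> is \<open>\<iota> (j, n) - \<iota> (j, k)\<close>: a product of coordinates of
  \<open>sum_map n r X\<close> is homogeneous in each vector \<open>X j k\<close>, of the same degree for all \<open>k\<close>.
  Hence only \<open>r (n + 1)\<close> of the \<open>2 r n\<close> exponents are free.\<close>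

definition exponents :: "nat \<Rightarrow> nat \<Rightarrow> nat \<Rightarrow> (nat \<times> nat \<Rightarrow> nat) set" where
  "exponents r n d = {\<iota> \<in> {..<r} \<times> {..n} \<rightarrow>\<^sub>E {..d}. \<forall>j<r. \<forall>k<n. \<iota> (j, k) \<le> \<iota> (j, n)}"

definition row :: "nat \<Rightarrow> (nat \<times> nat \<Rightarrow> nat) \<Rightarrow> nat \<Rightarrow> (nat \<Rightarrow> 2 \<Rightarrow> complex) \<Rightarrow> complex" where
  "row n \<iota> j x = (\<Prod>k<n. x k 1 ^ \<iota> (j, k) * x k 2 ^ (\<iota> (j, n) - \<iota> (j, k)))"

definition multihom :: "nat \<Rightarrow> nat \<Rightarrow> nat \<Rightarrow> ((nat \<Rightarrow> nat \<Rightarrow> 2 \<Rightarrow> complex) \<Rightarrow> complex) set" where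
  "multihom r n d = {g. \<exists>C. \<forall>X. g X = (\<Sum>\<iota>\<in>exponents r n d. C \<iota> * (\<Prod>j<r. row n \<iota> j (X j)))}"

lemma finite_exponents: "finite (exponents r n d)"
  unfolding exponents_def by (rule finite_subset[OF _ finite_PiE[of "{..<r} \<times> {..n}" "\<lambda>_. {..d}"]]) auto

lemma card_exponents: "card (exponents r n d) \<le> Suc d ^ (r * Suc n)"
proof -
  have "card (exponents r n d) \<le> card ({..<r} \<times> {..n} \<rightarrow>\<^sub>E {..d})"
    unfolding exponents_def by (intro card_mono finite_PiE) auto
  also have "\<dots> = Suc d ^ (r * Suc n)" by (simp add: card_PiE)
  finally show ?thesis .
qed

lemma multihom_add:
  assumes "g \<in> multihom r n d" "h \<in> multihom r n d"
  shows "(\<lambda>X. g X + h X) \<in> multihom r n d"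
proof -
  obtain C D where "\<forall>X. g X = (\<Sum>\<iota>\<in>exponents r n d. C \<iota> * (\<Prod>j<r. row n \<iota> j (X j)))"
    "\<forall>X. h X = (\<Sum>\<iota>\<in>exponents r n d. D \<iota> * (\<Prod>j<r. row n \<iota> j (X j)))"
    using assms unfolding multihom_def mem_Collect_eq by (elim exE)
  then show ?thesis
    unfolding multihom_def mem_Collect_eq
    by (intro exI[of _ "\<lambda>\<iota>. C \<iota> + D \<iota>"]) (simp add: algebra_simps sum.distrib)
qed

lemma multihom_monomial:
  assumes "\<iota> \<in> exponents r n d"
  shows "(\<lambda>X. c * (\<Prod>j<r. row n \<iota> j (X j))) \<in> multihom r n d"
  unfolding multihom_def mem_Collect_eq
proof (intro exI[of _ "\<lambda>\<kappa>. if \<kappa> = \<iota> then c else 0"] allI)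
  fix X :: "nat \<Rightarrow> nat \<Rightarrow> 2 \<Rightarrow> complex"
  have "(\<Sum>\<kappa>\<in>exponents r n d. (if \<kappa> = \<iota> then c else 0) * (\<Prod>j<r. row n \<kappa> j (X j))) =
      (\<Sum>\<kappa>\<in>exponents r n d. if \<kappa> = \<iota> then c * (\<Prod>j<r. row n \<iota> j (X j)) else 0)"
    by (intro sum.cong) auto
  then show "c * (\<Prod>j<r. row n \<iota> j (X j)) =
      (\<Sum>\<kappa>\<in>exponents r n d. (if \<kappa> = \<iota> then c else 0) * (\<Prod>j<r. row n \<kappa> j (X j)))"
    using assms by (simp add: finite_exponents)
qed

lemma multihom_zero: "(\<lambda>X. 0) \<in> multihom r n d"
  unfolding multihom_def by (auto intro: exI[of _ "\<lambda>_. 0"])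

lemma multihom_sum:
  "finite I \<Longrightarrow> (\<And>i. i \<in> I \<Longrightarrow> g i \<in> multihom r n d) \<Longrightarrow> (\<lambda>X. \<Sum>i\<in>I. g i X) \<in> multihom r n d"
  by (induction I rule: finite_induct) (simp_all add: multihom_zero multihom_add)

lemma multihom_le:
  assumes "g \<in> multihom r n d" "d \<le> e"
  shows "g \<in> multihom r n e"
proof -
  obtain C where C: "\<forall>X. g X = (\<Sum>\<iota>\<in>exponents r n d. C \<iota> * (\<Prod>j<r. row n \<iota> j (X j)))"
    using assms(1) unfolding multihom_def mem_Collect_eq by (elim exE)
  have "exponents r n d \<subseteq> exponents r n e"
    using PiE_mono[of "{..<r} \<times> {..n}" "\<lambda>_. {..d}" "\<lambda>_. {..e}"] assms(2)
    unfolding exponents_def by auto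
  then have "(\<lambda>X. \<Sum>\<iota>\<in>exponents r n d. C \<iota> * (\<Prod>j<r. row n \<iota> j (X j))) \<in> multihom r n e"
    by (intro multihom_sum finite_exponents multihom_monomial) auto
  then show ?thesis using C by (metis (no_types, lifting) ext)
qed

lemma multihom_one: "(\<lambda>X. 1) \<in> multihom r n 0"
proof -
  define \<iota> where "\<iota> = (\<lambda>x\<in>{..<r} \<times> {..n}. 0 :: nat)"
  have "\<iota> \<in> exponents r n 0" by (auto simp: exponents_def \<iota>_def)
  from multihom_monomial[OF this, of 1] show ?thesis by (simp add: row_def \<iota>_def)
qed

lemma multihom_times_coordinate:
  assumes g: "g \<in> multihom r n d" and \<alpha>: "length \<alpha> = n"
  shows "(\<lambda>X. g X * sum_map n r X \<alpha>) \<in> multihom r n (Suc d)"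
proof -
  obtain C where C: "\<forall>X. g X = (\<Sum>\<iota>\<in>exponents r n d. C \<iota> * (\<Prod>j<r. row n \<iota> j (X j)))"
    using g unfolding multihom_def mem_Collect_eq by (elim exE)
  \<comment> \<open>Multiplying by the \<open>j\<close>-th summand of the coordinate raises the
    common degree, stored at \<open>(j, n)\<close>, by one. The stored exponent of factor
    \<open>k\<close> grows only where \<open>\<alpha>\<close> selects the first basis vector;
    elsewhere the complementary exponent grows.\<close>
  define up where "up j \<iota> = (\<lambda>(j', k). if j' = j \<and> (k = n \<or> k < n \<and> \<alpha> ! k = 1)
    then Suc (\<iota> (j', k)) else \<iota> (j', k))" for j :: nat and \<iota>
  have up: "up j \<iota> \<in> exponents r n (Suc d)" if "\<iota> \<in> exponents r n d" "j < r" for j \<iota>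
  proof -
    have \<iota>: "\<iota> (j', k) \<le> d" if "j' < r" "k \<le> n" for j' k
      using \<open>\<iota> \<in> exponents r n d\<close> that by (auto simp: exponents_def PiE_def Pi_def)
    have "up j \<iota> \<in> {..<r} \<times> {..n} \<rightarrow>\<^sub>E {..Suc d}"
    proof (rule PiE_I)
      fix x assume "x \<in> {..<r} \<times> {..n}"
      then show "up j \<iota> x \<in> {..Suc d}" using \<iota>[of "fst x" "snd x"] by (auto simp: up_def)
    next
      fix x assume "x \<notin> {..<r} \<times> {..n}"
      then show "up j \<iota> x = undefined"
        using that by (cases x) (auto simp: up_def exponents_def PiE_def extensional_def)
    qed
    moreover have "up j \<iota> (j', k) \<le> up j \<iota> (j', n)" if "j' < r" "k < n" for j' k
      using \<open>\<iota> \<in> exponents r n d\<close> that by (auto simp: exponents_def up_def le_SucI)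
    ultimately show ?thesis by (simp add: exponents_def)
  qed
  have row_up: "row n (up j \<iota>) j' x = (if j' = j then row n \<iota> j x * tp n x \<alpha> else row n \<iota> j' x)"
    if "\<iota> \<in> exponents r n d" "j < r" for j j' \<iota> x
  proof (cases "j' = j")
    case True
    have "x k 1 ^ up j \<iota> (j, k) * x k 2 ^ (up j \<iota> (j, n) - up j \<iota> (j, k)) =
        x k 1 ^ \<iota> (j, k) * x k 2 ^ (\<iota> (j, n) - \<iota> (j, k)) * x k (\<alpha> ! k)" if "k < n" for k
    proof -
      have "\<iota> (j, k) \<le> \<iota> (j, n)" using \<open>\<iota> \<in> _\<close> \<open>j < r\<close> that by (auto simp: exponents_def)
      then show ?thesis using that exhaust_2[of "\<alpha> ! k"] by (auto simp: up_def Suc_diff_le)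
    qed
    then show ?thesis unfolding row_def tp_def using True by (simp add: prod.distrib[symmetric])
  qed (simp add: row_def up_def)
  have "(\<Prod>j'<r. row n \<iota> j' (X j')) * tp n (X j) \<alpha> = (\<Prod>j'<r. row n (up j \<iota>) j' (X j'))"
    if "\<iota> \<in> exponents r n d" "j < r" for j \<iota> X
  proof -
    have "(\<Prod>j'<r. row n (up j \<iota>) j' (X j')) =
        (\<Prod>j'<r. row n \<iota> j' (X j') * (if j' = j then tp n (X j) \<alpha> else 1))"
      using row_up[OF that] by (intro prod.cong) auto
    then show ?thesis using that(2) by (simp add: prod.distrib)
  qed
  then have "(\<lambda>X. g X * sum_map n r X \<alpha>) =
      (\<lambda>X. \<Sum>\<iota>\<in>exponents r n d. \<Sum>j<r. C \<iota> * (\<Prod>j'<r. row n (up j \<iota>) j' (X j')))"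
    using C \<alpha> by (simp add: sum_map_def sum_product mult.assoc)
  moreover have "\<dots> \<in> multihom r n (Suc d)"
    by (intro multihom_sum multihom_monomial up finite_exponents) auto
  ultimately show ?thesis by (simp only:)
qed

lemma multihom_times_power:
  assumes "g \<in> multihom r n d" "length \<alpha> = n"
  shows "(\<lambda>X. g X * sum_map n r X \<alpha> ^ e) \<in> multihom r n (d + e)"
proof (induction e)
  case 0
  then show ?case using assms(1) by simp
next
  case (Suc e)
  from multihom_times_coordinate[OF this assms(2)] show ?case by (simp add: mult_ac)
qed

lemma multihom_prod:
  assumes "\<And>i. i < (N::nat) \<Longrightarrow> length (f i) = n"
  shows "(\<lambda>X. \<Prod>i<N. sum_map n r X (f i) ^ e i) \<in> multihom r n (\<Sum>i<N. e i)"
  using assms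
proof (induction N)
  case 0
  then show ?case using multihom_one by simp
next
  case (Suc N)
  then have "(\<lambda>X. (\<Prod>i<N. sum_map n r X (f i) ^ e i) * sum_map n r X (f N) ^ e N) \<in> multihom r n ((\<Sum>i<N. e i) + e N)"
    by (intro multihom_times_power) simp_all
  then show ?case by simp
qed

lemma polynomial_functions_prod:
  "(\<And>i. i \<in> I \<Longrightarrow> p i \<in> polynomial_functions n) \<Longrightarrow> (\<lambda>T. \<Prod>i\<in>I. p i T) \<in> polynomial_functions n"
  by (induction I rule: infinite_finite_induct) (auto intro: polynomial_functions.intros)

lemma polynomial_functions_power:
  "p \<in> polynomial_functions n \<Longrightarrow> (\<lambda>T. p T ^ k) \<in> polynomial_functions n"
  by (induction k) (auto intro: polynomial_functions.intros)

lemma vanishing_polynomial: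
  assumes "r * Suc n < 2 ^ n"
  shows "\<exists>p\<in>polynomial_functions n. (\<exists>T. p T \<noteq> 0) \<and> (\<forall>X. p (sum_map n r X) = 0)"
proof -
  \<comment> \<open>\<open>K\<close> counts the monomials with all exponents below \<open>b\<close>,
    and \<open>D\<close> is their largest total degree. The base \<open>b\<close> exceeds N ^ (N -
    1), so that (N * b) ^ (N - 1) < b ^ N: there are more monomials than dimensions available after
    composition with \<open>sum_map\<close>.\<close>
  define N b K D where "N = (2::nat) ^ n" and "b = N ^ (N - 1) + 1" and "K = b ^ N" and "D = N * (b - 1)"
  have N: "1 \<le> N" by (simp add: N_def)
  have "card (idx n) = N"
    using card_lists_length_eq[of "UNIV :: 2 set" n] by (simp add: idx_def N_def)
  then obtain f where f: "bij_betw f {0..<N} (idx n)"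
    using ex_bij_betw_nat_finite[OF finite_idx[of n]] by auto
  have len: "length (f i) = n" if "i < N" for i
    using f that by (auto simp: bij_betw_def idx_def)
  define dig where "dig k i = k div b ^ i mod b" for k i
  define m where "m k T = (\<Prod>i<N. T (f i) ^ dig k i)" for k and T :: tensor
  have m_poly: "m k \<in> polynomial_functions n" for k
    unfolding m_def
    by (intro polynomial_functions_prod polynomial_functions_power polynomial_functions.coord len) simp
  have "\<exists>C. \<forall>X. m k (sum_map n r X) = (\<Sum>\<iota>\<in>exponents r n D. C \<iota> * (\<Prod>j<r. row n \<iota> j (X j)))" for k
  proof -
    have "dig k i \<le> b - 1" for i
    proof -
      have "dig k i < b" unfolding dig_def by (rule mod_less_divisor) (simp add: b_def)
      then show ?thesis by linarith
    qed
    then have "(\<Sum>i<N. dig k i) \<le> (\<Sum>i<N. b - 1)" by (intro sum_mono)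
    then have "(\<Sum>i<N. dig k i) \<le> D" by (simp add: D_def)
    with multihom_prod[of N f n r "dig k", OF len]
    have "(\<lambda>X. m k (sum_map n r X)) \<in> multihom r n D"
      unfolding m_def by (rule multihom_le)
    then show ?thesis unfolding multihom_def mem_Collect_eq .
  qed
  then have "\<forall>k. \<exists>C. \<forall>X. m k (sum_map n r X) = (\<Sum>\<iota>\<in>exponents r n D. C \<iota> * (\<Prod>j<r. row n \<iota> j (X j)))" ..
  from choice[OF this]
  obtain C where "\<forall>k X. m k (sum_map n r X) = (\<Sum>\<iota>\<in>exponents r n D. C k \<iota> * (\<Prod>j<r. row n \<iota> j (X j)))" ..
  then have C: "m k (sum_map n r X) = (\<Sum>\<iota>\<in>exponents r n D. C k \<iota> * (\<Prod>j<r. row n \<iota> j (X j)))" for k X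
    by simp
  \<comment> \<open>Each exponent pattern gives one linear condition on the coefficients of a
    combination of monomials; there are too few of them to force all coefficients to be
    zero.\<close>
  define V where "V = (\<lambda>\<iota> k. C k \<iota>) ` exponents r n D"
  have "card V \<le> card (exponents r n D)"
    unfolding V_def by (intro card_image_le finite_exponents)
  also have "\<dots> \<le> Suc D ^ (r * Suc n)" by (rule card_exponents)
  also have "\<dots> \<le> Suc D ^ (N - 1)" using assms by (intro power_increasing) (simp_all add: N_def)
  also have "\<dots> \<le> (N * b) ^ (N - 1)"
  proof (rule power_mono)
    have "N * (b - 1) + N = N * b" by (simp add: b_def)
    then show "Suc D \<le> N * b" using N by (simp add: D_def)
  qed simp
  also have "\<dots> = N ^ (N - 1) * b ^ (N - 1)" by (rule power_mult_distrib)
  also have "\<dots> < b * b ^ (N - 1)" by (intro mult_strict_right_mono) (simp_all add: b_def)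
  also have "\<dots> = K" using N by (simp add: K_def power_eq_if)
  finally have "\<not> separating {..<K} V"
    using separating_card[of "{..<K}" V] by (auto simp: V_def finite_exponents)
  then obtain \<phi> k0 where \<phi>: "\<forall>v\<in>V. (\<Sum>k<K. \<phi> k * v k) = 0" "k0 < K" "\<phi> k0 \<noteq> 0"
    unfolding separating_def by auto
  define p where "p T = (\<Sum>k<K. \<phi> k * m k T)" for T
  have "p \<in> polynomial_functions n"
    unfolding p_def
    by (intro polynomial_functions_sum polynomial_functions.mult polynomial_functions.const m_poly)
  moreover have "p (sum_map n r X) = 0" for X
  proof -
    have "p (sum_map n r X) = (\<Sum>\<iota>\<in>exponents r n D. (\<Sum>k<K. \<phi> k * C k \<iota>) * (\<Prod>j<r. row n \<iota> j (X j)))"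
      unfolding p_def C sum_distrib_left sum_distrib_right mult.assoc by (rule sum.swap)
    also have "\<dots> = 0" using \<phi>(1) by (intro sum.neutral) (simp add: V_def)
    finally show ?thesis .
  qed
  moreover have "\<exists>T. p T \<noteq> 0"
  proof -
    define P where "P = (\<Sum>k<K. monom (\<phi> k) k)"
    have "coeff P k0 \<noteq> 0" using \<phi>(2,3) by (simp add: P_def coeff_sum coeff_monom)
    then have "P \<noteq> 0" by auto
    then obtain z where z: "poly P z \<noteq> 0" using poly_all_0_iff_0 by blast
    \<comment> \<open>Kronecker substitution: the exponents of the \<open>k\<close>-th monomial are
      the digits of \<open>k\<close> in base \<open>b\<close>, so at \<open>T\<close> it takes the
      value z ^ k.\<close>
    define T where "T \<alpha> = z ^ (b ^ inv_into {0..<N} f \<alpha>)" for \<alpha>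
    have "m k T = z ^ k" if "k < K" for k
    proof -
      have "inv_into {0..<N} f (f i) = i" if "i < N" for i
        using that f by (intro inv_into_f_f) (auto simp: bij_betw_def)
      then have "m k T = (\<Prod>i<N. z ^ (dig k i * b ^ i))"
        unfolding m_def T_def by (intro prod.cong) (simp_all add: power_mult[symmetric] mult.commute)
      also have "\<dots> = z ^ (\<Sum>i<N. dig k i * b ^ i)" by (simp add: power_sum)
      also have "(\<Sum>i<N. dig k i * b ^ i) = k"
        unfolding dig_def digit_sum using that by (simp add: K_def)
      finally show ?thesis .
    qed
    then have "p T = poly P z" by (simp add: p_def P_def poly_sum poly_monom)
    with z show ?thesis by (intro exI[of _ T]) simp
  qed
  ultimately show ?thesis by (intro bexI[of _ p]) simp_all
qed

section \<open>The generic rank\<close>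

lemma sum_of_decomposables_iff: "sum_of_decomposables n s T \<longleftrightarrow> (\<exists>X. T = sum_map n s X)"
proof -
  have dec: "decomposable n D \<longleftrightarrow> (\<exists>x. D = (\<lambda>i. if length i = n then tp n x i else 0))" for D
  proof
    assume "decomposable n D"
    then obtain vs where vs: "length vs = n" "D = tensor_product vs" unfolding decomposable_def by auto
    then have "D = (\<lambda>i. if length i = n then tp n (\<lambda>k b. vs ! k $ b) i else 0)"
      by (simp add: tensor_product_def tp_def fun_eq_iff)
    then show "\<exists>x. D = (\<lambda>i. if length i = n then tp n x i else 0)" by (intro exI)
  next
    assume "\<exists>x. D = (\<lambda>i. if length i = n then tp n x i else 0)"
    then obtain x where x: "D = (\<lambda>i. if length i = n then tp n x i else 0)" ..
    have "D = tensor_product (map (\<lambda>k. \<chi> b. x k b) [0..<n])"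
      unfolding x by (auto simp: tensor_product_def tp_def fun_eq_iff intro!: prod.cong)
    then show "decomposable n D" unfolding decomposable_def
      by (intro exI[of _ "map (\<lambda>k. \<chi> b. x k b) [0..<n]"]) simp
  qed
  show ?thesis
  proof
    assume "sum_of_decomposables n s T"
    then obtain D where D: "\<forall>j<s. decomposable n (D j)" "T = (\<lambda>i. \<Sum>j<s. D j i)"
      unfolding sum_of_decomposables_def by (elim exE conjE)
    then have "\<forall>j. \<exists>x. j < s \<longrightarrow> D j = (\<lambda>i. if length i = n then tp n x i else 0)"
      unfolding dec by simp
    from choice[OF this] obtain X where "\<forall>j. j < s \<longrightarrow> D j = (\<lambda>i. if length i = n then tp n (X j) i else 0)" ..
    then have "T = sum_map n s X" unfolding D(2) by (simp add: sum_map_def fun_eq_iff)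
    then show "\<exists>X. T = sum_map n s X" by (rule exI[of _ X])
  next
    assume "\<exists>X. T = sum_map n s X"
    then obtain X where X: "T = sum_map n s X" ..
    show "sum_of_decomposables n s T"
      unfolding sum_of_decomposables_def
    proof (intro exI[of _ "\<lambda>j i. if length i = n then tp n (X j) i else 0"] conjI allI impI)
      fix j
      show "decomposable n (\<lambda>i. if length i = n then tp n (X j) i else 0)"
        unfolding dec by (rule exI[of _ "X j"]) (rule refl)
    qed (simp add: X sum_map_def fun_eq_iff)
  qed
qed

lemma polyfun_restrict:
  assumes "P \<in> polyfun"
  shows "(\<lambda>T. P (case_sum (\<lambda>i. if length i = n then T i else c (Inl i)) (\<lambda>v. c (Inr v)))) \<in> polynomial_functions n"
  using assms
proof induction
  case (var v)
  show ?case
  proof (cases v)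
    case (Inl i)
    then show ?thesis
      by (cases "length i = n") (simp_all add: polynomial_functions.const polynomial_functions.coord)
  qed (simp add: polynomial_functions.const)
qed (auto intro: polynomial_functions.intros)

text \<open>The sums are the projection of the graph of \<open>sum_map\<close>, with the coordinates
  of the tensor as \<open>Inl\<close> and those of the vectors as \<open>Inr\<close>. The projection
  is constructible, and \<open>sums_dense\<close> excludes the thin alternative.\<close>

lemma sums_contain_open:
  assumes "1 \<le> n" "Fill n s 0"
  shows "\<exists>g\<in>polynomial_functions n. (\<exists>T. g T \<noteq> 0) \<and> (\<forall>T\<in>tensors n. g T \<noteq> 0 \<longrightarrow> (\<exists>X. T = sum_map n s X))"
proof -
  obtain X0 :: "nat \<Rightarrow> nat \<Rightarrow> 2 \<Rightarrow> complex" where "fills n {..<s} {s..<s+0} X0"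
    using assms(2) unfolding Fill_def ..
  then have X0: "fills n {..<s} {} X0" by simp
  define e :: "2 list \<Rightarrow> (2 list + nat \<times> nat \<times> 2 \<Rightarrow> complex) \<Rightarrow> complex" where
    "e \<alpha> c = c (Inl \<alpha>) - (\<Sum>j<s. \<Prod>k<n. c (Inr (j, k, \<alpha> ! k)))" for \<alpha> c
  define S0 where "S0 = {c. (\<forall>f\<in>e ` idx n. f c = 0) \<and> (1::complex) \<noteq> 0}"
  have "constructible S0"
    unfolding S0_def
  proof (rule constructible.basic)
    show "e ` idx n \<subseteq> polyfun"
      unfolding e_def by (auto intro!: polyfun_diff polyfun.var polyfun_sum polyfun_prod)
  qed (simp_all add: polyfun.const)
  define W :: "(2 list + nat \<times> nat \<times> 2) set" where "W = Inr ` ({..<s} \<times> {..<n} \<times> UNIV)"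
  define R where "R = {c. \<exists>w. (\<lambda>v. if v \<in> W then w v else c v) \<in> S0}"
  have R: "constructible R"
    unfolding R_def by (rule constructible_project_finite[OF _ \<open>constructible S0\<close>]) (simp add: W_def)
  have R_iff: "c \<in> R \<longleftrightarrow> (\<exists>X. \<forall>\<alpha>\<in>idx n. c (Inl \<alpha>) = sum_map n s X \<alpha>)" for c
  proof
    assume "c \<in> R"
    then obtain w where w: "(\<lambda>v. if v \<in> W then w v else c v) \<in> S0" unfolding R_def by auto
    have "\<forall>\<alpha>\<in>idx n. c (Inl \<alpha>) = sum_map n s (\<lambda>j k b. w (Inr (j, k, b))) \<alpha>"
      using w by (auto simp: S0_def e_def W_def sum_map_def tp_def idx_def image_iff)
    then show "\<exists>X. \<forall>\<alpha>\<in>idx n. c (Inl \<alpha>) = sum_map n s X \<alpha>"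
      by (rule exI[of _ "\<lambda>j k b. w (Inr (j, k, b))"])
  next
    assume "\<exists>X. \<forall>\<alpha>\<in>idx n. c (Inl \<alpha>) = sum_map n s X \<alpha>"
    then obtain X where X: "\<forall>\<alpha>\<in>idx n. c (Inl \<alpha>) = sum_map n s X \<alpha>" ..
    define w :: "2 list + nat \<times> nat \<times> 2 \<Rightarrow> complex" where "w = case_sum (\<lambda>_. 0) (\<lambda>(j, k, b). X j k b)"
    have "(\<lambda>v. if v \<in> W then w v else c v) \<in> S0"
      using X by (auto simp: S0_def e_def W_def w_def sum_map_def tp_def idx_def image_iff)
    then show "c \<in> R" unfolding R_def by auto
  qed
  \<comment> \<open>All variables other than the coordinates of an order \<open>n\<close> tensor are
    frozen at \<open>c\<close>, which turns a polynomial in all variables into one on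
    tensors.\<close>
  define res where "res c T = case_sum (\<lambda>i. if length i = n then T i else c (Inl i)) (\<lambda>v. c (Inr v))"
    for c :: "2 list + nat \<times> nat \<times> 2 \<Rightarrow> complex" and T
  have res_id: "res c (\<lambda>i. c (Inl i)) = c" for c
    by (auto simp: res_def fun_eq_iff split: sum.split)
  have res_Inl: "res c T (Inl \<alpha>) = T \<alpha>" if "\<alpha> \<in> idx n" for c T \<alpha>
    using that by (simp add: res_def idx_def)
  have poly: "(\<lambda>T. P (res c T)) \<in> polynomial_functions n" if "P \<in> polyfun" for P c
    unfolding res_def by (rule polyfun_restrict[OF that])
  from constructible_thin_or_thick[OF R] show ?thesis
  proof
    assume "\<exists>h\<in>polyfun. (\<exists>c. h c \<noteq> 0) \<and> (\<forall>c\<in>R. h c = 0)"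
    then obtain h c where h: "h \<in> polyfun" "h c \<noteq> 0" "\<forall>c\<in>R. h c = 0" by (elim bexE conjE exE)
    have "h (res c (sum_map n s X)) = 0" for X
    proof -
      have "res c (sum_map n s X) \<in> R" unfolding R_iff using res_Inl by (intro exI[of _ X]) simp
      then show ?thesis using h(3) by simp
    qed
    from sums_dense[OF assms(1) X0 poly[OF h(1)] this, of "\<lambda>i. c (Inl i)"] show ?thesis
      using h(2) by (simp add: res_id)
  next
    assume "\<exists>g\<in>polyfun. (\<exists>c. g c \<noteq> 0) \<and> (\<forall>c. g c \<noteq> 0 \<longrightarrow> c \<in> R)"
    then obtain g c where g: "g \<in> polyfun" "g c \<noteq> 0" "\<forall>c. g c \<noteq> 0 \<longrightarrow> c \<in> R" by (elim bexE conjE exE)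
    show ?thesis
    proof (intro bexI[of _ "\<lambda>T. g (res c T)"] conjI ballI impI)
      show "\<exists>T. g (res c T) \<noteq> 0" by (rule exI[of _ "\<lambda>i. c (Inl i)"]) (simp add: res_id g(2))
    next
      fix T assume T: "T \<in> tensors n" "g (res c T) \<noteq> 0"
      then have "res c T \<in> R" using g(3) by simp
      then obtain X where "\<forall>\<alpha>\<in>idx n. res c T (Inl \<alpha>) = sum_map n s X \<alpha>" unfolding R_iff ..
      then have "T = sum_map n s X"
        using T(1) res_Inl by (auto simp: fun_eq_iff sum_map_def tensors_def idx_def)
      then show "\<exists>X. T = sum_map n s X" by (rule exI[of _ X])
    qed (rule poly[OF g(1)])
  qed
qed

text \<open>Padding uses zero vectors, whose product is the zero tensor; for \<open>n = 0\<close>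
  the empty product would be 1.\<close>

lemma sum_map_extend:
  assumes "1 \<le> n" "r \<le> s"
  shows "\<exists>Y. sum_map n r X = sum_map n s Y"
proof -
  define Y where "Y j = (if j < r then X j else (\<lambda>_ _. 0))" for j
  have "tp n (\<lambda>_ _. 0) i = 0" for i using assms(1) by (auto simp: tp_def)
  then have "(\<Sum>j<s. tp n (Y j) i) = (\<Sum>j<r. tp n (Y j) i)" for i
    using assms(2) by (intro sum.mono_neutral_right) (auto simp: Y_def)
  also have "\<dots> i = (\<Sum>j<r. tp n (X j) i)" for i by (intro sum.cong) (auto simp: Y_def)
  finally have "sum_map n r X = sum_map n s Y" by (simp add: sum_map_def fun_eq_iff)
  then show ?thesis by (rule exI[of _ Y])
qed

lemma polynomial_functions_polyfun: "p \<in> polynomial_functions n \<Longrightarrow> p \<in> polyfun"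
  by (induction rule: polynomial_functions.induct) (auto intro: polyfun.intros)

theorem mainTheorem2:
  fixes n s :: nat
  assumes "n \<ge> 1"
    and "s = nat \<lceil>(2 ^ n :: real) / real (n + 1)\<rceil>"
  shows "generic_tensor n
           (\<lambda>T. sum_of_decomposables n s T \<and> (\<forall>r<s. \<not> sum_of_decomposables n r T))"
proof -
  define x where "x = (2 ^ n :: real) / real (n + 1)"
  have "0 < x" by (simp add: x_def)
  moreover have "s = nat \<lceil>x\<rceil>" using assms(2) by (simp only: x_def)
  ultimately have "real s = of_int \<lceil>x\<rceil>" by simp
  then have "x \<le> real s" "real s < x + 1" by linarith+
  then have "2 ^ n \<le> real (n + 1) * real s" "real (n + 1) * real s < 2 ^ n + real (n + 1)"
    by (simp_all add: x_def field_simps)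
  then have "real (2 ^ n) \<le> real ((n + 1) * s)" "real ((n + 1) * s) < real (2 ^ n + (n + 1))"
    unfolding of_nat_mult of_nat_add[of "2 ^ n"] of_nat_power of_nat_numeral .
  then have lower: "2 ^ n \<le> (n + 1) * s" and upper: "(n + 1) * s < 2 ^ n + (n + 1)"
    by (simp_all only: of_nat_le_iff of_nat_less_iff)
  have "s \<noteq> 0" using lower by (intro notI) simp
  \<comment> \<open>One polynomial vanishing on sums of s - 1 terms excludes every smaller number of
    terms, since shorter sums can be padded.\<close>
  then obtain s' where s': "s = Suc s'" by (cases s) auto
  have "s' * Suc n < 2 ^ n" using upper by (simp add: s' algebra_simps)
  from vanishing_polynomial[OF this] obtain p S
    where p: "p \<in> polynomial_functions n" "p S \<noteq> 0" "\<forall>X. p (sum_map n s' X) = 0"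
    by (elim bexE conjE exE)
  from sums_contain_open[OF assms(1) Fill_generic_rank[OF assms(1) lower upper]] obtain g S'
    where g: "g \<in> polynomial_functions n" "g S' \<noteq> 0"
      "\<forall>T\<in>tensors n. g T \<noteq> 0 \<longrightarrow> (\<exists>X. T = sum_map n s X)" by (elim bexE conjE exE)
  have "\<exists>T. p T \<noteq> 0 \<and> g T \<noteq> 0"
    using polyfun_common_nonzero[where P = p and Q = g and a = S and b = S']
      polynomial_functions_polyfun[OF p(1)] polynomial_functions_polyfun[OF g(1)] p(2) g(2) by simp
  then obtain T where T: "p T \<noteq> 0" "g T \<noteq> 0" by (elim exE conjE)
  \<comment> \<open>The common nonvanishing point may have entries at lists of the wrong length;
    they are removed to obtain a tensor, which the two polynomials do not notice.\<close>
  define T' where "T' i = (if length i = n then T i else 0)" for i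
  have T': "T' \<in> tensors n" "p T' \<noteq> 0" "g T' \<noteq> 0"
    using T polynomial_functions_cong[OF p(1), of T' T] polynomial_functions_cong[OF g(1), of T' T]
    by (simp_all add: T'_def tensors_def)
  define U where "U = {T \<in> tensors n. p T * g T \<noteq> 0}"
  have "tensors n - U = {T \<in> tensors n. \<forall>q\<in>{\<lambda>T. p T * g T}. q T = 0}" by (auto simp: U_def)
  moreover have "{\<lambda>T. p T * g T} \<subseteq> polynomial_functions n"
    using polynomial_functions.mult[OF p(1) g(1)] by simp
  ultimately have "zariski_closed n (tensors n - U)"
    unfolding zariski_closed_def by (intro exI[of _ "{\<lambda>T. p T * g T}"] conjI)
  then have "zariski_open n U" unfolding zariski_open_def by (auto simp: U_def)
  moreover have "U \<noteq> {}" using T' by (auto simp: U_def)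
  moreover have "\<forall>T\<in>U. sum_of_decomposables n s T \<and> (\<forall>r<s. \<not> sum_of_decomposables n r T)"
  proof (intro ballI conjI allI impI)
    fix T assume "T \<in> U"
    then show "sum_of_decomposables n s T"
      using g(3) by (simp add: U_def sum_of_decomposables_iff)
  next
    fix T r assume T: "T \<in> U" and "r < s"
    show "\<not> sum_of_decomposables n r T"
    proof
      assume "sum_of_decomposables n r T"
      then obtain X where X: "T = sum_map n r X" unfolding sum_of_decomposables_iff ..
      have "\<exists>Y. sum_map n r X = sum_map n s' Y"
        using assms(1) \<open>r < s\<close> s' by (intro sum_map_extend) simp_all
      then obtain Y where "T = sum_map n s' Y" using X by auto
      then have "p T = 0" using p(3) by simp
      with T show False by (simp add: U_def)
    qed
  qed
  ultimately show ?thesis unfolding generic_tensor_def by (intro exI[of _ U] conjI)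
qed

end
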